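(* Let $q=p^m$ with $p$ prime and $m\in\mathbb{N}$, and let $k\in\{3,4\}$ with $k\mid\frac{q-1}{p-1}$ such that $(k,q)$ is not a semiprimitive pair. Then $\Gamma(k,q)$ and its complement $\bar\Gamma(k,q)$ are equienergetic if and only if exactly one of the non-principal eigenvalues of $\Gamma(k,q)$ is positive. In this case, the graphs $\Gamma(k,q)$, $\Gamma^+(k,q)$ and $\bar\Gamma(k,q)$ are mutually equienergetic and pairwise non-isospectral.
   Context: For a prime power $q$ and $k\mid q-1$, let $R_k=\{x^k: x\in\mathbb{F}_q^*\}$. $\Gamma(k,q)$ is the graph on $\mathbb{F}_q$ in which $v,w$ are adjacent iff $w-v\in R_k$ (a regular graph of degree $|R_k|=\frac{q-1}{k}$); $\Gamma^+(k,q)$ is the graph on $\mathbb{F}_q$ with adjacency matrix $A_{v,w}=1$ iff $v+w\in R_k$ (loops allowed). $\bar\Gamma$ denotes the complement graph. The pair $(k,q)$ with $q=p^m$ is semiprimitive if $-1$ is congruent to a power of $p$ modulo $k$. The principal eigenvalue of a regular graph is its degree; the other eigenvalues are non-principal. The energy of a graph is the sum of the absolute values of its adjacency eigenvalues; two graphs are equienergetic if they have the same energy and isospectral if they have the same spectrum. *)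

theory Defs
  imports
    Complex_Main
    "HOL-Number_Theory.Cong"
    "HOL-Library.Cardinality"
    "HOL-Library.Countable_Set"
    "Jordan_Normal_Form.Char_Poly"
begin

text \<open>A graph on the vertex set \<open>UNIV :: 'v set\<close> is given by its adjacency relation; loops are allowed.\<close>

type_synonym 'v graph = "'v \<Rightarrow> 'v \<Rightarrow> bool"

definition complement_graph :: "'v graph \<Rightarrow> 'v graph" where
  "complement_graph E = (\<lambda>v w. v \<noteq> w \<and> \<not> E v w)"

definition regular_graph :: "'v::finite graph \<Rightarrow> nat \<Rightarrow> bool" where
  "regular_graph E d \<longleftrightarrow> (\<forall>v. card {w. E v w} = d)"

text \<open>Matrices of Jordan_Normal_Form are indexed by natural numbers, so the vertices are listed by
  \<open>from_nat_into UNIV\<close>, a bijection from \<open>{..<CARD('v)}\<close> (lemma \<open>bij_betw_from_nat_into_finite\<close>);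
  another enumeration would give a similar matrix.  The entries are complex so that the
  characteristic polynomial always splits.\<close>

definition adjacency_matrix :: "'v::finite graph \<Rightarrow> complex mat" where
  "adjacency_matrix E =
     mat CARD('v) CARD('v)
       (\<lambda>(i, j). if E (from_nat_into UNIV i) (from_nat_into UNIV j) then 1 else 0)"

definition graph_spectrum :: "'v::finite graph \<Rightarrow> complex multiset" where
  "graph_spectrum E = proots (char_poly (adjacency_matrix E))"

definition energy :: "'v::finite graph \<Rightarrow> real" where
  "energy E = (\<Sum>\<mu>\<in>#graph_spectrum E. cmod \<mu>)"

definition equienergetic :: "'v::finite graph \<Rightarrow> 'w::finite graph \<Rightarrow> bool" where
  "equienergetic E F \<longleftrightarrow> energy E = energy F"

definition isospectral :: "'v::finite graph \<Rightarrow> 'w::finite graph \<Rightarrow> bool" where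
  "isospectral E F \<longleftrightarrow> graph_spectrum E = graph_spectrum F"

text \<open>Meaningful for regular graphs only, where the degree \<open>d\<close> is unique.\<close>

definition principal_eigenvalue :: "'v::finite graph \<Rightarrow> complex" where
  "principal_eigenvalue E = of_nat (THE d. regular_graph E d)"

definition nonprincipal_eigenvalues :: "'v::finite graph \<Rightarrow> complex set" where
  "nonprincipal_eigenvalues E =
     {\<mu>. eigenvalue (adjacency_matrix E) \<mu> \<and> \<mu> \<noteq> principal_eigenvalue E}"

definition power_residues :: "nat \<Rightarrow> 'a::field set" where
  "power_residues k = {x ^ k | x. x \<noteq> 0}"

definition gp_graph :: "nat \<Rightarrow> 'a::field graph" where
  "gp_graph k = (\<lambda>v w. w - v \<in> power_residues k)"

definition gp_sum_graph :: "nat \<Rightarrow> 'a::field graph" where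
  "gp_sum_graph k = (\<lambda>v w. v + w \<in> power_residues k)"

definition semiprimitive_pair :: "nat \<Rightarrow> nat \<Rightarrow> bool" where
  "semiprimitive_pair k q \<longleftrightarrow>
     (\<exists>p m j. prime p \<and> m > 0 \<and> q = p ^ m \<and> [- 1 = int p ^ j] (mod int k))"

lemma regular_graph_gp_graph:
  "regular_graph (gp_graph k :: 'a::{field,finite} graph) (card (power_residues k :: 'a set))"
  unfolding regular_graph_def gp_graph_def
proof
  fix v :: 'a
  have "{w. w - v \<in> power_residues k} = (\<lambda>x. x + v) ` power_residues k"
    by (force simp: image_iff algebra_simps)
  then show "card {w. w - v \<in> power_residues k} = card (power_residues k :: 'a set)"
    by (simp add: card_image)
qed

lemma principal_eigenvalue_gp_graph:
  "principal_eigenvalue (gp_graph k :: 'a::{field,finite} graph)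
     = of_nat (card (power_residues k :: 'a set))"
proof -
  have "(THE d. regular_graph (gp_graph k :: 'a graph) d) = card (power_residues k :: 'a set)"
    using regular_graph_gp_graph[where ?'a = 'a, of k] by (intro the_equality) (auto simp: regular_graph_def)
  then show ?thesis by (simp add: principal_eigenvalue_def)
qed

end

theory Submission
  imports Defs "Jordan_Normal_Form.Schur_Decomposition"
begin

text \<open>
  The graphs \<open>\<Gamma>(k,q)\<close> and its complement are Cayley graphs, so the additive characters of the field
  diagonalise them: with \<open>R\<close> the set of \<open>k\<close>-th powers and \<open>n = (q - 1) / k\<close>, the eigenvalues of
  \<open>\<Gamma>(k,q)\<close> are \<open>n\<close> and the Gaussian periods \<open>\<eta> a = (\<Sum>x\<in>R. \<psi> (a x))\<close>, \<open>a \<noteq> 0\<close>, and those of the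
  complement are \<open>q - 1 - n\<close> and \<open>- 1 - \<eta> a\<close>.  As \<open>k\<close> divides \<open>(q - 1) / (p - 1)\<close>, the prime field lies
  in \<open>R\<close>, which makes the periods integers, congruent to \<open>n\<close> modulo \<open>p\<close> and hence nonzero.  So
  \<open>\<bar>- 1 - \<eta> a\<bar> - \<bar>\<eta> a\<bar>\<close> is \<open>1\<close> or \<open>- 1\<close> according to the sign of \<open>\<eta> a\<close>, and the energies agree iff
  exactly \<open>n\<close> elements \<open>a \<noteq> 0\<close>, i.e. one coset of \<open>R\<close>, have a positive period.

  It remains to see that different cosets have different periods.  Semiprimitivity fails exactly if
  \<open>p \<equiv> 1 (mod k)\<close>.  A coincidence of two periods, inserted into their first three moments,
  determines modulo \<open>p\<close> the number of \<open>x \<in> R\<close> for which \<open>1 + x\<close> is a cube (\<open>k = 3\<close>) or a square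
  (\<open>k = 4\<close>).  Counting the same solutions by power sums in the field gives a result that differs by
  the binomial coefficient \<open>2 n choose n\<close>, which is not divisible by \<open>p\<close>.

  The adjacency matrices of \<open>\<Gamma>(k,q)\<close> and \<open>\<Gamma>\<^sup>+(k,q)\<close> have the same square, because \<open>- R = R\<close>, hence these
  graphs are equienergetic; traces and the largest eigenvalues separate the three spectra.
\<close>

section \<open>Power sums and consecutive residues in finite fields\<close>

text \<open>Translation by 1 permutes the field but changes the sum of all elements by
  \<open>CARD('a)\<close> ones.\<close>

lemma of_nat_card_eq_zero: "of_nat CARD('a::{field,finite}) = (0::'a)"
proof -
  have "(\<Sum>x\<in>(UNIV::'a set). x) = (\<Sum>x\<in>(UNIV::'a set). x + 1)"
    by (rule sum.reindex_bij_witness[where i = "\<lambda>x. x + 1" and j = "\<lambda>x. x - 1"]) auto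
  then show ?thesis by (simp add: sum.distrib)
qed

lemma CHAR_eq_prime_of_card:
  assumes "prime p" "CARD('a::{field,finite}) = p ^ m"
  shows "CHAR('a) = p"
proof -
  have "of_nat CARD('a) = (0::'a)" by (rule of_nat_card_eq_zero)
  then have "of_nat p = (0::'a)"
    using assms by simp
  then have "CHAR('a) dvd p"
    by (simp add: of_nat_eq_0_iff_char_dvd)
  moreover have "CHAR('a) \<noteq> 1"
    using of_nat_CHAR[where ?'a = 'a] by (metis of_nat_1 one_neq_zero)
  ultimately show ?thesis
    using assms(1) by (auto simp: prime_nat_iff)
qed

lemma one_less_card_field: "1 < CARD('a::{field,finite})"
proof -
  have "card {0, 1::'a} \<le> CARD('a)"
    by (rule card_mono) auto
  then show ?thesis by simp
qed

text \<open>Multiplication by \<open>x\<close> permutes the units, so their product absorbs one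
  factor \<open>x\<close> per unit.\<close>

lemma power_card_minus_one_eq_one:
  fixes x :: "'a::{field,finite}"
  assumes "x \<noteq> 0"
  shows "x ^ (CARD('a) - 1) = 1"
proof -
  have "(\<Prod>y\<in>UNIV - {0}. y) = (\<Prod>y\<in>UNIV - {0}. x * y)"
    by (rule prod.reindex_bij_witness[where i = "\<lambda>y. x * y" and j = "\<lambda>y. y / x"]) (use assms in auto)
  also have "\<dots> = x ^ (CARD('a) - 1) * (\<Prod>y\<in>UNIV - {0}. y)"
    by (simp add: prod.distrib card_Diff_singleton)
  finally show ?thesis by simp
qed

lemma card_roots_of_unity_le:
  fixes c :: "'a::field"
  assumes "n > 0"
  shows "finite {x. x ^ n = c}" "card {x. x ^ n = c} \<le> n"
proof -
  define f where "f = monom 1 n - [:c:]"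
  have "poly.coeff f n = 1"
    using assms by (simp add: f_def coeff_pCons split: nat.split)
  then have "f \<noteq> 0" by auto
  have "degree f \<le> n"
    unfolding f_def by (rule degree_diff_le) (auto simp: degree_monom_le)
  moreover have "{x. x ^ n = c} = {x. poly f x = 0}"
    by (simp add: f_def poly_monom)
  ultimately show "finite {x. x ^ n = c}" "card {x. x ^ n = c} \<le> n"
    using poly_roots_finite[OF \<open>f \<noteq> 0\<close>] card_poly_roots_bound[OF \<open>f \<noteq> 0\<close>] by auto
qed

text \<open>Fibres of the \<open>k\<close>-th power map have at most \<open>k\<close> elements, so
  its image has at least \<open>n\<close>; the image lies among the at most \<open>n\<close> roots
  of \<open>x ^ n = 1\<close>, which forces equality.\<close>

lemma power_residues_eq:
  assumes "k * n = CARD('a::{field,finite}) - 1"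
  shows "power_residues k = {x::'a. x ^ n = 1}" "card {x::'a. x ^ n = 1} = n"
proof -
  have pos: "k > 0" "n > 0"
    using assms one_less_card_field[where ?'a = 'a] by (auto intro!: Nat.gr0I)
  let ?R = "power_residues k :: 'a set"
  have img: "?R = (\<lambda>x. x ^ k) ` (UNIV - {0})"
    by (auto simp: power_residues_def)
  have sub: "?R \<subseteq> {x. x ^ n = 1}"
  proof
    fix y assume "y \<in> ?R"
    then obtain x where "x \<noteq> 0" "y = x ^ k" by (auto simp: power_residues_def)
    then show "y \<in> {x. x ^ n = 1}"
      using power_card_minus_one_eq_one[of x] assms by (simp flip: power_mult)
  qed
  have "k * n = card (UNIV - {0::'a})"
    using assms by (simp add: card_Diff_singleton)
  also have "\<dots> = card (\<Union>y\<in>?R. {x. x ^ k = y} \<inter> (UNIV - {0}))"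
    by (rule arg_cong[of _ _ card]) (auto simp: img)
  also have "\<dots> \<le> (\<Sum>y\<in>?R. card ({x. x ^ k = y} \<inter> (UNIV - {0})))"
    by (rule card_UN_le) simp
  also have "\<dots> \<le> (\<Sum>y\<in>?R. k)"
  proof (rule sum_mono)
    fix y :: 'a
    have "card ({x. x ^ k = y} \<inter> (UNIV - {0})) \<le> card {x. x ^ k = y}"
      using card_roots_of_unity_le(1)[OF pos(1)] by (intro card_mono) auto
    then show "card ({x. x ^ k = y} \<inter> (UNIV - {0})) \<le> k"
      using card_roots_of_unity_le(2)[OF pos(1)] order_trans by blast
  qed
  finally have "n \<le> card ?R"
    using pos by simp
  moreover have "card ?R \<le> card {x::'a. x ^ n = 1}"
    by (rule card_mono) (use sub in auto)
  moreover have "card {x::'a. x ^ n = 1} \<le> n"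
    using card_roots_of_unity_le(2) pos by blast
  ultimately show "?R = {x. x ^ n = 1}" "card {x::'a. x ^ n = 1} = n"
    using card_subset_eq[OF _ sub] by auto
qed

section \<open>Counting consecutive residues by power sums\<close>

text \<open>If some unit \<open>c\<close> has \<open>c ^ e\<close> different from 1, the
  substitution of \<open>c * x\<close> for \<open>x\<close> forces the sum to vanish. Otherwise
  every unit contributes 1; for \<open>e = 0\<close> the term at 0 counts as well.\<close>

lemma sum_power_finite_field:
  "(\<Sum>x\<in>(UNIV::'a::{field,finite} set). x ^ e) = (if e > 0 \<and> CARD('a) - 1 dvd e then - 1 else 0)"
proof -
  let ?N = "CARD('a) - 1"
  have N: "?N > 0" using one_less_card_field[where ?'a = 'a] by simp
  have card0: "of_nat CARD('a) = (0::'a)" by (rule of_nat_card_eq_zero)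
  consider "e = 0" | "e > 0" "?N dvd e" | "\<not> ?N dvd e" by auto
  then show ?thesis
  proof cases
    case 1
    then show ?thesis using card0 by simp
  next
    case 2
    then have "x ^ e = (if x = 0 then 0 else 1)" for x :: 'a
      using power_card_minus_one_eq_one[of x] by (auto simp: power_mult elim!: dvdE)
    then have "(\<Sum>x\<in>(UNIV::'a set). x ^ e) = (\<Sum>x\<in>UNIV - {0::'a}. 1)"
      by (simp add: sum.remove[of UNIV "0::'a"])
    also have "\<dots> = of_nat CARD('a) - (1::'a)"
      using N by (simp add: card_Diff_singleton of_nat_diff)
    finally show ?thesis using 2 card0 by simp
  next
    case 3
    define r where "r = e mod ?N"
    have r: "0 < r" "r < ?N"
      using 3 N by (auto simp: r_def mod_greater_zero_iff_not_dvd)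
    \<comment> \<open>If there were no such \<open>c\<close>, all \<open>?N\<close> units would be
      roots of \<open>c ^ r = 1\<close> with \<open>r < ?N\<close>.\<close>
    have "\<exists>c::'a. c \<noteq> 0 \<and> c ^ e \<noteq> 1"
    proof (rule ccontr)
      assume "\<not> ?thesis"
      then have *: "c ^ e = 1" if "c \<noteq> 0" for c :: 'a using that by auto
      have "c ^ r = 1" if "c \<noteq> 0" for c :: 'a
      proof -
        have "c ^ e = (c ^ ?N) ^ (e div ?N) * c ^ r"
          unfolding r_def by (simp flip: power_mult power_add)
        then show ?thesis
          using *[OF that] power_card_minus_one_eq_one[OF that] by simp
      qed
      then have "card (UNIV - {0::'a}) \<le> card {c::'a. c ^ r = 1}"
        by (intro card_mono) auto
      also have "\<dots> \<le> r"
        using card_roots_of_unity_le(2) r by blast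
      finally show False
        using r by (simp add: card_Diff_singleton)
    qed
    then obtain c :: 'a where c: "c \<noteq> 0" "c ^ e \<noteq> 1" by auto
    have "(\<Sum>x\<in>(UNIV::'a set). x ^ e) = (\<Sum>x\<in>(UNIV::'a set). (c * x) ^ e)"
      by (rule sum.reindex_bij_witness[where i = "\<lambda>x. c * x" and j = "\<lambda>x. x / c"]) (use c in auto)
    also have "\<dots> = c ^ e * (\<Sum>x\<in>(UNIV::'a set). x ^ e)"
      by (simp add: power_mult_distrib sum_distrib_left)
    finally have "(\<Sum>x\<in>(UNIV::'a set). x ^ e) = 0"
      using c by simp
    then show ?thesis using 3 by simp
  qed
qed

text \<open>In the binomial expansion only the monomial of degree \<open>CARD('a) - 1\<close>
  survives: the bound on \<open>u + v\<close> excludes larger multiples, and degree 0 sums to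
  0.\<close>

lemma sum_power_times_power_Suc:
  assumes "u \<le> CARD('a::{field,finite}) - 1" "u + v < 2 * (CARD('a) - 1)"
  shows "(\<Sum>x\<in>(UNIV::'a set). x ^ u * (1 + x) ^ v) = - of_nat (v choose (CARD('a) - 1 - u))"
proof -
  let ?N = "CARD('a) - 1"
  have "(\<Sum>x\<in>(UNIV::'a set). x ^ u * (1 + x) ^ v)
      = (\<Sum>x\<in>(UNIV::'a set). \<Sum>j\<le>v. of_nat (v choose j) * x ^ (u + j))"
    by (simp add: add.commute[of 1] binomial_ring sum_distrib_left power_add mult_ac)
  also have "\<dots> = (\<Sum>j\<le>v. of_nat (v choose j) * (\<Sum>x\<in>(UNIV::'a set). x ^ (u + j)))"
    by (subst sum.swap) (simp add: sum_distrib_left)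
  also have "\<dots> = (\<Sum>j\<le>v. if j = ?N - u then - of_nat (v choose j) else 0)"
  proof (rule sum.cong[OF refl])
    fix j assume "j \<in> {..v}"
    then have "u + j < 2 * ?N" using assms(2) by simp
    then have "(u + j > 0 \<and> ?N dvd u + j) \<longleftrightarrow> j = ?N - u"
      using assms(1) one_less_card_field[where ?'a = 'a]
        dvd_imp_le[of ?N "u + j"] dvd_imp_le[of ?N "u + j - ?N"] dvd_diff_nat[of ?N "u + j" ?N]
      by (cases "u + j = ?N") auto
    then show "of_nat (v choose j) * (\<Sum>x\<in>(UNIV::'a set). x ^ (u + j))
        = (if j = ?N - u then - of_nat (v choose j) else 0)"
      by (simp add: sum_power_finite_field)
  qed
  also have "\<dots> = - of_nat (v choose (?N - u))"
    by (simp add: binomial_eq_0)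
  finally show ?thesis .
qed

text \<open>The geometric sum \<open>\<Sum>a<k. x ^ (a * A)\<close> is \<open>k\<close> times the indicator of \<open>x ^ A = 1\<close>,
  except that it is \<open>1\<close> at \<open>x = 0\<close>; evaluated in the field, it gives the count modulo \<open>p\<close>.\<close>

lemma card_consecutive_roots_of_unity:
  assumes A: "k * A = CARD('a::{field,finite}) - 1" and B: "l * B = CARD('a) - 1"
    and minus_one: "(- 1 :: 'a) ^ A = 1"
  shows "(of_nat (k * l * card {x::'a. x ^ A = 1 \<and> (1 + x) ^ B = 1}) :: 'a)
    = (\<Sum>a<k. \<Sum>b<l. \<Sum>x\<in>UNIV. x ^ (a * A) * (1 + x) ^ (b * B)) - of_nat (k + l)"
proof -
  let ?T = "{x::'a. x ^ A = 1 \<and> (1 + x) ^ B = 1}"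
  define f where "f k A x = (\<Sum>a<k. x ^ (a * A))" for k A :: nat and x :: 'a
  have pos: "k > 0" "A > 0" "l > 0" "B > 0"
    using A B one_less_card_field[where ?'a = 'a] by (auto intro!: Nat.gr0I)
  have f: "f k A x = (if x = 0 then 1 else if x ^ A = 1 then of_nat k else 0)"
    if "k * A = CARD('a) - 1" "k > 0" "A > 0" for k A x
  proof (cases "x = 0")
    case True
    then have "f k A x = (\<Sum>a<k. if a = 0 then 1 else 0)"
      unfolding f_def using that by (intro sum.cong) auto
    then show ?thesis using True that by simp
  next
    case False
    have eq: "f k A x = (\<Sum>a<k. (x ^ A) ^ a)"
      by (simp add: f_def mult.commute flip: power_mult)
    have "(x ^ A) ^ k = 1"
      using power_card_minus_one_eq_one[OF False] that by (simp add: mult.commute flip: power_mult)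
    then show ?thesis
      using False by (cases "x ^ A = 1") (auto simp: eq geometric_sum)
  qed
  \<comment> \<open>The two points where one factor degenerates to 1 are \<open>x = 0\<close> and
    \<open>x = -1\<close>; there the other factor is \<open>l\<close> and \<open>k\<close>, which is
    the source of the correction \<open>k + l\<close>.\<close>
  have f0: "f k A 0 = 1" "f l B 0 = 1" and f1: "f l B 1 = of_nat l" "f k A (-1) = of_nat k"
    using f A B pos minus_one by auto
  have "(\<Sum>x\<in>UNIV. f k A x * f l B (1 + x))
      = (\<Sum>x\<in>UNIV. (if x \<in> ?T then of_nat (k * l) else 0)
          + (if x = 0 then of_nat l else 0) + (if x = -1 then of_nat k else 0))"
  proof (rule sum.cong[OF refl])
    fix x :: 'a
    consider "x = 0" | "x = -1" "x \<noteq> 0" | "x \<noteq> 0" "1 + x \<noteq> 0"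
      by (metis add.right_neutral add_minus_cancel add.commute)
    then show "f k A x * f l B (1 + x) = (if x \<in> ?T then of_nat (k * l) else 0)
          + (if x = 0 then of_nat l else 0) + (if x = -1 then of_nat k else 0)"
      using pos f0 f1 minus_one by cases (auto simp: f[OF A] f[OF B] power_0_left)
  qed
  also have "\<dots> = of_nat (k * l * card ?T) + of_nat (k + l)"
    by (simp add: sum.distrib flip: sum.inter_filter sum.inter_restrict)
  finally have "of_nat (k * l * card ?T) = (\<Sum>x\<in>UNIV. f k A x * f l B (1 + x)) - of_nat (k + l)"
    by simp
  also have "(\<Sum>x\<in>UNIV. f k A x * f l B (1 + x))
      = (\<Sum>x\<in>UNIV. \<Sum>a<k. \<Sum>b<l. x ^ (a * A) * (1 + x) ^ (b * B))"
    by (simp add: f_def sum_product)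
  also have "\<dots> = (\<Sum>a<k. \<Sum>b<l. \<Sum>x\<in>UNIV. x ^ (a * A) * (1 + x) ^ (b * B))"
    by (subst sum.swap) (rule sum.cong[OF refl], rule sum.swap)
  finally show ?thesis .
qed

text \<open>Among the nine power sums only the index pairs (1, 2), (2, 1) and (2, 2) contribute; the
  last one yields the central binomial coefficient. The constant 8 is 2 + (3 + 3).\<close>

lemma card_consecutive_cubic_residues:
  assumes n: "3 * n = CARD('a::{field,finite}) - 1" and "(- 1 :: 'a) ^ n = 1"
  shows "of_nat (9 * card {x::'a. x ^ n = 1 \<and> (1 + x) ^ n = 1} + 8 + (2 * n choose n)) = (0::'a)"
proof -
  have "n > 0" using n one_less_card_field[where ?'a = 'a] by auto
  then have S: "(\<Sum>x\<in>(UNIV::'a set). x ^ u * (1 + x) ^ v) = - of_nat (v choose (3 * n - u))"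
    if "u \<le> 2 * n" "v \<le> 2 * n" for u v
    using that n sum_power_times_power_Suc[of u v, where ?'a = 'a] by simp
  have "(\<Sum>a<3. \<Sum>b<3. \<Sum>x\<in>(UNIV::'a set). x ^ (a * n) * (1 + x) ^ (b * n))
      = (\<Sum>a<3. \<Sum>b<3. - of_nat (b * n choose (3 * n - a * n)))"
    by (intro sum.cong refl S) auto
  also have "\<dots> = - of_nat (2 + (2 * n choose n))"
    using \<open>n > 0\<close> by (simp add: lessThan_nat_numeral lessThan_Suc binomial_eq_0 flip: diff_mult_distrib)
  finally have "of_nat (9 * card {x::'a. x ^ n = 1 \<and> (1 + x) ^ n = 1})
      = - of_nat (2 + (2 * n choose n)) - (of_nat 6 :: 'a)"
    using card_consecutive_roots_of_unity[OF n n assms(2)] by simp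
  then show ?thesis
    by (simp only: of_nat_add) simp
qed

text \<open>Testing \<open>1 + x\<close> only for being a square leaves just the index pairs (2, 1)
  and (3, 1), and so a single nontrivial binomial coefficient. The constant 7 is 1 + (4 +
  2).\<close>

lemma card_consecutive_quartic_square_residues:
  assumes n: "4 * n = CARD('a::{field,finite}) - 1" and "(- 1 :: 'a) ^ n = 1"
  shows "of_nat (8 * card {x::'a. x ^ n = 1 \<and> (1 + x) ^ (2 * n) = 1} + 7 + (2 * n choose n)) = (0::'a)"
proof -
  have "n > 0" using n one_less_card_field[where ?'a = 'a] by auto
  then have S: "(\<Sum>x\<in>(UNIV::'a set). x ^ u * (1 + x) ^ v) = - of_nat (v choose (4 * n - u))"
    if "u \<le> 3 * n" "v \<le> 2 * n" for u v
    using that n sum_power_times_power_Suc[of u v, where ?'a = 'a] by simp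
  have n2: "2 * (2 * n) = CARD('a) - 1" using n by simp
  have "(\<Sum>a<4. \<Sum>b<2. \<Sum>x\<in>(UNIV::'a set). x ^ (a * n) * (1 + x) ^ (b * (2 * n)))
      = (\<Sum>a<4. \<Sum>b<2. - of_nat (b * (2 * n) choose (4 * n - a * n)))"
    by (intro sum.cong refl S) auto
  also have "\<dots> = - of_nat (1 + (2 * n choose n))"
    using \<open>n > 0\<close> by (simp add: lessThan_nat_numeral lessThan_Suc binomial_eq_0 flip: diff_mult_distrib)
  finally have "of_nat (8 * card {x::'a. x ^ n = 1 \<and> (1 + x) ^ (2 * n) = 1})
      = - of_nat (1 + (2 * n choose n)) - (of_nat 6 :: 'a)"
    using card_consecutive_roots_of_unity[OF n n2 assms(2)] by simp
  then show ?thesis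
    by (simp only: of_nat_add) simp
qed

section \<open>Central binomial coefficients modulo a prime\<close>

text \<open>The multiples of \<open>p\<close> up to \<open>p * N + b\<close> have product
  \<open>p ^ N * fact N\<close>; the remaining factors are prime to \<open>p\<close>.\<close>

lemma fact_mult_prime_add:
  fixes p N b :: nat
  assumes "prime p" "b < p"
  shows "\<exists>u. fact (p * N + b) = p ^ N * fact N * u \<and> \<not> p dvd u"
  using assms(2)
proof (induction N arbitrary: b)
  case 0
  then show ?case using assms(1) by (auto simp: prime_dvd_fact_iff)
next
  case (Suc N)
  show ?case using Suc.prems
  proof (induction b)
    case 0
    have p: "p > 1" using assms(1) prime_gt_1_nat by blast
    obtain u where u: "fact (p * N + (p - 1)) = p ^ N * fact N * u" "\<not> p dvd u"
      using Suc.IH[of "p - 1"] p by auto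
    have "p * Suc N + 0 = Suc (p * N + (p - 1))" using p by simp
    then have "fact (p * Suc N + 0) = (p * Suc N) * fact (p * N + (p - 1))"
      by (metis add_0_right fact_Suc of_nat_id)
    then show ?case using u by (auto simp: algebra_simps)
  next
    case (Suc b)
    then obtain u where u: "fact (p * Suc N + b) = p ^ Suc N * fact (Suc N) * u" "\<not> p dvd u"
      by auto
    have "\<not> p dvd p * Suc N + Suc b"
      using Suc.prems by (metis dvd_add_right_iff dvd_triv_left nat_dvd_not_less zero_less_Suc)
    then have "\<not> p dvd u * (p * Suc N + Suc b)"
      using u(2) prime_dvd_mult_iff[OF assms(1)] by blast
    moreover have "fact (p * Suc N + Suc b) = p ^ Suc N * fact (Suc N) * (u * (p * Suc N + Suc b))"
      using u(1) by (simp only: add_Suc_right fact_Suc of_nat_id mult_ac)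
    ultimately show ?case by blast
  qed
qed

text \<open>A case of Lucas' theorem: the last digit \<open>b\<close> doubles without a carry, so
  the powers of \<open>p\<close> in the factorials cancel and only the coefficient for
  \<open>N\<close> can bring in a factor \<open>p\<close>.\<close>

lemma prime_not_dvd_central_binomial_mult_add:
  fixes p N b :: nat
  assumes p: "prime p" and "2 * b < p" and N: "\<not> p dvd (2 * N choose N)"
  shows "\<not> p dvd (2 * (p * N + b) choose (p * N + b))"
proof
  assume dvd: "p dvd (2 * (p * N + b) choose (p * N + b))"
  obtain u where u: "fact (p * (2 * N) + 2 * b) = p ^ (2 * N) * fact (2 * N) * u" "\<not> p dvd u"
    using fact_mult_prime_add[OF p assms(2)] by blast
  obtain v where v: "fact (p * N + b) = p ^ N * fact N * v" "\<not> p dvd v"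
    using fact_mult_prime_add[OF p, of b N] assms(2) by auto
  have central: "fact M * fact M * (2 * M choose M) = (fact (2 * M) :: nat)" for M
    using binomial_fact_lemma[of M "2 * M"] by (simp add: mult_ac)
  have "p ^ (2 * N) * (fact N * fact N) * (v * v * (2 * (p * N + b) choose (p * N + b)))
      = fact (p * N + b) * fact (p * N + b) * (2 * (p * N + b) choose (p * N + b))"
    unfolding v(1) by (simp add: power_mult power2_eq_square power_mult_distrib algebra_simps flip: power_add)
  also have "\<dots> = fact (p * (2 * N) + 2 * b)"
    by (simp only: central distrib_left[of 2, symmetric] mult.left_commute[of p 2])
  also have "\<dots> = p ^ (2 * N) * (fact N * fact N) * ((2 * N choose N) * u)"
    unfolding u(1) central[of N, symmetric] by (simp add: algebra_simps)
  finally have "v * v * (2 * (p * N + b) choose (p * N + b)) = (2 * N choose N) * u"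
    using p prime_gt_0_nat by simp
  then have "p dvd (2 * N choose N) * u"
    using dvd by (metis dvd_mult)
  then show False
    using p N u(2) by (simp add: prime_dvd_mult_iff)
qed

text \<open>All base-\<open>p\<close> digits of \<open>n\<close> are equal to \<open>(p - 1) / k\<close>, so that doubling \<open>n\<close> causes no carry.\<close>

lemma prime_not_dvd_central_binomial:
  fixes p k m n :: nat
  assumes p: "prime p" and k: "k > 1" and cong: "[p = 1] (mod k)" and n: "k * n = p ^ m - 1"
  shows "\<not> p dvd (2 * n choose n)"
  using n
proof (induction m arbitrary: n)
  case 0
  then show ?case using k p by (auto simp: prime_nat_iff)
next
  case (Suc m)
  have p1: "p > 1" using p prime_gt_1_nat by blast
  obtain b where b: "k * b = p - 1"
    using cong p1 by (metis cong_to_1_nat dvd_def)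
  have "k dvd p ^ m - 1"
    using cong by (metis cong_pow cong_to_1_nat power_one)
  then obtain N where N: "k * N = p ^ m - 1" by (metis dvdE)
  \<comment> \<open>Dropping the last base-\<open>p\<close> digit \<open>b = (p - 1) / k\<close> of
    \<open>n\<close> leaves the number \<open>N\<close> belonging to \<open>p ^ m\<close>.\<close>
  have "k * n = k * (p * N + b)"
  proof -
    have "p ^ m > 0" using p1 by simp
    then have "p * (p ^ m - 1) + (p - 1) = p ^ Suc m - 1"
      using p1 by (simp add: diff_mult_distrib2)
    then show ?thesis
      using Suc.prems N b by (metis distrib_left mult.left_commute)
  qed
  then have "n = p * N + b" using k by simp
  moreover have "2 * b < p"
  proof -
    have "2 * b \<le> k * b" using k by (intro mult_right_mono) auto
    then show ?thesis using b p1 by simp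
  qed
  ultimately show ?case
    using prime_not_dvd_central_binomial_mult_add[OF p] Suc.IH[OF N] by blast
qed

section \<open>Spectra of matrices and of Cayley graphs\<close>

lemma proots_prod_linear: "proots (\<Prod>a\<leftarrow>as. [:- a, 1:]) = mset (as :: 'a::idom list)"
proof (induction as)
  case (Cons a as)
  have "(\<Prod>a\<leftarrow>as. [:- a, 1:]) \<noteq> 0"
    by (auto simp: prod_list_zero_iff)
  then show ?case
    using Cons by (simp add: proots_mult del: mult_pCons_left)
qed simp

lemma spectrum_upper_triangular:
  fixes A :: "'a::idom mat"
  assumes "A \<in> carrier_mat n n" "upper_triangular A"
  shows "proots (char_poly A) = mset (diag_mat A)"
  using char_poly_upper_triangular[OF assms] by (simp add: proots_prod_linear)

lemma complex_mat_triangularizable: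
  fixes A :: "complex mat"
  assumes "A \<in> carrier_mat n n"
  obtains B where "B \<in> carrier_mat n n" "upper_triangular B" "similar_mat A B"
  using char_poly_factorized[OF assms] schur_decomposition_exists[OF assms] by blast

text \<open>Squaring an upper triangular matrix squares its diagonal, so triangularisation keeps
  track of multiplicities without diagonalisability.\<close>

lemma spectrum_square:
  fixes A :: "complex mat"
  assumes A: "A \<in> carrier_mat n n"
  shows "proots (char_poly (A * A)) = image_mset (\<lambda>x. x\<^sup>2) (proots (char_poly A))"
proof -
  obtain B where B: "B \<in> carrier_mat n n" "upper_triangular B" "similar_mat A B"
    using complex_mat_triangularizable[OF A] .
  obtain P Q where "similar_mat_wit A B P Q"
    using B(3) by (auto simp: similar_mat_def)
  then have "similar_mat (A ^\<^sub>m 2) (B ^\<^sub>m 2)"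
    using similar_mat_wit_pow similar_mat_def by blast
  then have "similar_mat (A * A) (B * B)"
    using A B(1) by (simp add: numeral_2_eq_2)
  then have "char_poly (A * A) = char_poly (B * B)"
    by (rule char_poly_similar)
  have entry: "(B * B) $$ (i, j) = (\<Sum>l<n. B $$ (i, l) * B $$ (l, j))" if "i < n" "j < n" for i j
    using B(1) that by (auto simp: scalar_prod_def atLeast0LessThan)
  have zero: "B $$ (i, j) = 0" if "j < i" "i < n" for i j
    using B(1,2) that by (auto simp: upper_triangular_def)
  have "upper_triangular (B * B)"
    unfolding upper_triangular_def
  proof (intro allI impI)
    fix i j assume "i < dim_row (B * B)" "j < i"
    then have ij: "i < n" "j < i" using B(1) by auto
    have "(\<Sum>l<n. B $$ (i, l) * B $$ (l, j)) = 0"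
    proof (rule sum.neutral, rule ballI)
      fix l assume "l \<in> {..<n}"
      then show "B $$ (i, l) * B $$ (l, j) = 0"
        using zero[of l i] zero[of j l] ij by (cases "l < i") auto
    qed
    then show "(B * B) $$ (i, j) = 0" using entry ij by simp
  qed
  moreover have "diag_mat (B * B) = map (\<lambda>x. x\<^sup>2) (diag_mat B)"
  proof (rule nth_equalityI)
    show "length (diag_mat (B * B)) = length (map (\<lambda>x. x\<^sup>2) (diag_mat B))"
      using B(1) by (simp add: diag_mat_def)
    fix i assume "i < length (diag_mat (B * B))"
    then have i: "i < n" using B(1) by (simp add: diag_mat_def)
    have "(\<Sum>l<n. B $$ (i, l) * B $$ (l, i)) = (\<Sum>l<n. if l = i then (B $$ (i, i))\<^sup>2 else 0)"
    proof (rule sum.cong[OF refl])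
      fix l assume "l \<in> {..<n}"
      then show "B $$ (i, l) * B $$ (l, i) = (if l = i then (B $$ (i, i))\<^sup>2 else 0)"
        using zero[of l i] zero[of i l] i by (cases l i rule: linorder_cases) (auto simp: power2_eq_square)
    qed
    then show "diag_mat (B * B) ! i = map (\<lambda>x. x\<^sup>2) (diag_mat B) ! i"
      using B(1) i entry[of i i] by (simp add: diag_mat_def)
  qed
  ultimately have "proots (char_poly (B * B)) = image_mset (\<lambda>x. x\<^sup>2) (proots (char_poly B))"
    using B(1,2) spectrum_upper_triangular[of "B * B" n] spectrum_upper_triangular[of B n]
    by simp
  then show ?thesis
    using char_poly_similar[OF B(3)] \<open>char_poly (A * A) = char_poly (B * B)\<close> by simp
qed

lemma sum_diag_mult_commute:
  fixes A B :: "'a::comm_semiring_0 mat"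
  assumes "A \<in> carrier_mat n n" "B \<in> carrier_mat n n"
  shows "(\<Sum>i<n. (A * B) $$ (i, i)) = (\<Sum>i<n. (B * A) $$ (i, i))"
proof -
  have "(\<Sum>i<n. (A * B) $$ (i, i)) = (\<Sum>i<n. \<Sum>j<n. A $$ (i, j) * B $$ (j, i))"
    using assms by (intro sum.cong) (auto simp: scalar_prod_def atLeast0LessThan)
  also have "\<dots> = (\<Sum>j<n. \<Sum>i<n. B $$ (j, i) * A $$ (i, j))"
    by (subst sum.swap) (simp add: mult.commute)
  also have "\<dots> = (\<Sum>i<n. (B * A) $$ (i, i))"
    using assms by (intro sum.cong) (auto simp: scalar_prod_def atLeast0LessThan)
  finally show ?thesis .
qed

text \<open>The trace is invariant under similarity, and a triangular matrix has its spectrum on the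
  diagonal.\<close>

lemma sum_spectrum_eq_trace:
  fixes A :: "complex mat"
  assumes A: "A \<in> carrier_mat n n"
  shows "(\<Sum>x\<in>#proots (char_poly A). x) = (\<Sum>i<n. A $$ (i, i))"
proof -
  obtain B where B: "B \<in> carrier_mat n n" "upper_triangular B" "similar_mat A B"
    using complex_mat_triangularizable[OF A] .
  obtain P Q where PQ: "similar_mat_wit A B P Q"
    using B(3) by (auto simp: similar_mat_def)
  note w = similar_mat_witD2[OF A PQ]
  have "(\<Sum>i<n. A $$ (i, i)) = (\<Sum>i<n. (P * (B * Q)) $$ (i, i))"
    using w by (simp add: assoc_mult_mat[of P n n B n Q n])
  also have "\<dots> = (\<Sum>i<n. ((B * Q) * P) $$ (i, i))"
    by (rule sum_diag_mult_commute) (use w in auto)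
  also have "(B * Q) * P = B"
    using w by (simp add: assoc_mult_mat[of B n n Q n P n])
  also have "(\<Sum>i<n. B $$ (i, i)) = sum_list (diag_mat B)"
    using B(1) by (simp add: diag_mat_def interv_sum_list_conv_sum_set_nat atLeast0LessThan)
  also have "\<dots> = (\<Sum>x\<in>#proots (char_poly B). x)"
    using spectrum_upper_triangular[OF B(1,2)] by (simp flip: sum_mset_sum_list)
  finally show ?thesis
    using char_poly_similar[OF B(3)] by simp
qed

section \<open>Loops, walks of length two and energies of graphs\<close>

lemma adjacency_matrix_carrier [simp]:
  "adjacency_matrix (E :: 'v::finite graph) \<in> carrier_mat CARD('v) CARD('v)"
  by (simp add: adjacency_matrix_def)

lemma bij_betw_vertices: "bij_betw (from_nat_into (UNIV :: 'v::finite set)) {..<CARD('v)} UNIV"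
  by (rule bij_betw_from_nat_into_finite) simp

text \<open>The trace of an adjacency matrix counts loops; this later separates the sum graph from
  the two loopless graphs.\<close>

lemma sum_graph_spectrum:
  "(\<Sum>\<mu>\<in>#graph_spectrum E. \<mu>) = of_nat (card {v. (E :: 'v::finite graph) v v})"
proof -
  have "(\<Sum>\<mu>\<in>#graph_spectrum E. \<mu>)
      = (\<Sum>i<CARD('v). (\<lambda>v. if E v v then 1 else 0) (from_nat_into UNIV i))"
    unfolding graph_spectrum_def sum_spectrum_eq_trace[OF adjacency_matrix_carrier]
    by (simp add: adjacency_matrix_def)
  also have "\<dots> = (\<Sum>v\<in>UNIV. if E v v then 1 else 0)"
    by (rule sum.reindex_bij_betw[OF bij_betw_vertices])
  finally show ?thesis by (simp flip: sum.inter_filter)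
qed

text \<open>The energy is the sum of \<open>sqrt \<bar>\<nu>\<bar>\<close> over the spectrum of the squared matrix.\<close>

lemma energy_eq_if_adjacency_squares_eq:
  fixes E F :: "'v::finite graph"
  assumes "adjacency_matrix E * adjacency_matrix E = adjacency_matrix F * adjacency_matrix F"
  shows "energy E = energy F"
proof -
  have "energy G = (\<Sum>\<nu>\<in>#proots (char_poly (adjacency_matrix G * adjacency_matrix G)). sqrt (cmod \<nu>))"
    for G :: "'v graph"
    by (simp add: spectrum_square[OF adjacency_matrix_carrier] energy_def graph_spectrum_def
        norm_power multiset.map_comp comp_def)
  then show ?thesis using assms by simp
qed

lemma adjacency_matrix_square:
  assumes "i < CARD('v)" "j < CARD('v)"
  shows "(adjacency_matrix E * adjacency_matrix (E :: 'v::finite graph)) $$ (i, j)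
    = of_nat (card {u. E (from_nat_into UNIV i) u \<and> E u (from_nat_into UNIV j)})"
proof -
  let ?v = "from_nat_into (UNIV :: 'v set)"
  have "(adjacency_matrix E * adjacency_matrix E) $$ (i, j)
      = (\<Sum>l<CARD('v). (\<lambda>u. if E (?v i) u \<and> E u (?v j) then 1 else 0) (?v l))"
    using assms by (auto simp: adjacency_matrix_def scalar_prod_def atLeast0LessThan intro!: sum.cong)
  also have "\<dots> = (\<Sum>u\<in>UNIV. if E (?v i) u \<and> E u (?v j) then 1 else 0)"
    by (rule sum.reindex_bij_betw[OF bij_betw_vertices])
  finally show ?thesis by (simp flip: sum.inter_filter)
qed

text \<open>For symmetric \<open>S\<close>, negating the middle vertex carries the walks of length
  two in the sum graph to those in the difference graph with the same ends, so the adjacency squares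
  agree.\<close>

lemma energy_difference_graph_eq_energy_sum_graph:
  fixes S :: "'v::{ab_group_add,finite} set"
  assumes "\<And>x. x \<in> S \<Longrightarrow> - x \<in> S"
  shows "energy (\<lambda>v w. w - v \<in> S) = energy (\<lambda>v w. v + w \<in> S)"
proof (rule energy_eq_if_adjacency_squares_eq, rule eq_matI)
  fix i j
  let ?v = "from_nat_into (UNIV :: 'v set)"
  let ?A = "adjacency_matrix (\<lambda>v w. w - v \<in> S)" and ?B = "adjacency_matrix (\<lambda>v w. v + w \<in> S)"
  assume "i < dim_row (?B * ?B)" "j < dim_col (?B * ?B)"
  then have ij: "i < CARD('v)" "j < CARD('v)"
    by (auto simp: adjacency_matrix_def)
  have "- x \<in> S \<longleftrightarrow> x \<in> S" for x
    using assms[of x] assms[of "- x"] by auto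
  from this[of "?v i + _"] this[of "_ - ?v i"]
  have "- u - ?v i \<in> S \<longleftrightarrow> ?v i + u \<in> S" "?v i - u \<in> S \<longleftrightarrow> u - ?v i \<in> S" for u
    by (metis minus_add minus_diff_eq diff_conv_add_uminus add.commute)+
  then have "bij_betw uminus {u. ?v i + u \<in> S \<and> u + ?v j \<in> S} {u. u - ?v i \<in> S \<and> ?v j - u \<in> S}"
    by (intro bij_betw_byWitness[where f' = uminus]) (auto simp: add.commute)
  then show "(?A * ?A) $$ (i, j) = (?B * ?B) $$ (i, j)"
    using ij by (simp add: adjacency_matrix_square bij_betw_same_card)
qed (auto simp: adjacency_matrix_def)

section \<open>Additive characters and the spectrum of Cayley graphs\<close>

locale additive_character =
  fixes psi :: "'a::{field,finite} \<Rightarrow> complex"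
  assumes psi_add: "psi (x + y) = psi x * psi y"
    and psi_nontrivial: "\<exists>x. psi x \<noteq> 1"
    and psi_0 [simp]: "psi 0 = 1"
begin

text \<open>Orthogonality: a shift by \<open>y / a\<close> multiplies the sum by
  \<open>psi y\<close>, which can be chosen different from 1.\<close>

lemma sum_psi: "(\<Sum>x\<in>UNIV. psi (a * x)) = (if a = 0 then of_nat CARD('a) else 0)"
proof (cases "a = 0")
  case False
  obtain y where y: "psi y \<noteq> 1" using psi_nontrivial by blast
  have "(\<Sum>x\<in>UNIV. psi (a * x)) = (\<Sum>x\<in>UNIV. psi (a * (x + y / a)))"
    by (rule sum.reindex_bij_witness[where i = "\<lambda>x. x + y / a" and j = "\<lambda>x. x - y / a"]) auto
  also have "\<dots> = psi y * (\<Sum>x\<in>UNIV. psi (a * x))"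
    using False by (simp add: distrib_left psi_add sum_distrib_left mult.commute)
  finally show ?thesis using False y by simp
qed simp

text \<open>Summation over all frequencies \<open>a\<close> detects the solutions of
  \<open>f i = 0\<close>; the moments of the periods are computed from this.\<close>

lemma sum_sum_psi:
  assumes "finite I"
  shows "(\<Sum>a\<in>UNIV. \<Sum>i\<in>I. psi (a * f i)) = of_nat (CARD('a) * card {i \<in> I. f i = 0})"
proof -
  have "(\<Sum>a\<in>UNIV. \<Sum>i\<in>I. psi (a * f i)) = (\<Sum>i\<in>I. \<Sum>a\<in>UNIV. psi (f i * a))"
    by (subst sum.swap) (simp add: mult.commute)
  also have "\<dots> = (\<Sum>i\<in>I. if f i = 0 then of_nat CARD('a) else 0)"
    by (simp add: sum_psi)
  also have "\<dots> = of_nat (CARD('a) * card {i \<in> I. f i = 0})"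
    using assms by (simp add: mult.commute flip: sum.inter_filter)
  finally show ?thesis .
qed

definition cayley_eigenvalue :: "'a set \<Rightarrow> 'a \<Rightarrow> complex" where
  "cayley_eigenvalue S a = (\<Sum>s\<in>S. psi (a * s))"

text \<open>The columns of \<open>P\<close> are the characters
  \<open>x \<mapsto> psi (a * x)\<close>. They are eigenvectors because a shift acts on a character
  as a scalar, and orthogonality makes \<open>Q\<close> the inverse of \<open>P\<close>.\<close>

lemma graph_spectrum_cayley:
  "graph_spectrum (\<lambda>v w. w - v \<in> S) = image_mset (cayley_eigenvalue S) (mset_set UNIV)"
proof -
  let ?q = "CARD('a)"
  let ?v = "from_nat_into (UNIV :: 'a set)"
  let ?A = "adjacency_matrix (\<lambda>v w :: 'a. w - v \<in> S)"
  define P where "P = mat ?q ?q (\<lambda>(i, j). psi (?v i * ?v j))"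
  define Q where "Q = mat ?q ?q (\<lambda>(i, j). psi (- (?v i * ?v j)) / of_nat ?q)"
  define D where "D = mat ?q ?q (\<lambda>(i, j). if i = j then cayley_eigenvalue S (?v i) else 0)"
  have carrier: "P \<in> carrier_mat ?q ?q" "Q \<in> carrier_mat ?q ?q" "D \<in> carrier_mat ?q ?q"
    by (auto simp: P_def Q_def D_def)
  have vertex_eq: "?v i = ?v j \<longleftrightarrow> i = j" if "i < ?q" "j < ?q" for i j
    using bij_betw_imp_inj_on[OF bij_betw_vertices] that by (auto dest: inj_onD)
  have sum_vertices: "(\<Sum>i<?q. h (?v i)) = (\<Sum>x\<in>UNIV. h x)" for h :: "'a \<Rightarrow> complex"
    by (rule sum.reindex_bij_betw[OF bij_betw_vertices])
  have PQ: "P * Q = 1\<^sub>m ?q"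
  proof (rule eq_matI)
    fix i j assume "i < dim_row (1\<^sub>m ?q :: complex mat)" "j < dim_col (1\<^sub>m ?q :: complex mat)"
    then have ij: "i < ?q" "j < ?q" by auto
    have "(P * Q) $$ (i, j) = (\<Sum>l<?q. psi (?v i * ?v l) * (psi (- (?v l * ?v j)) / of_nat ?q))"
      using ij by (simp add: P_def Q_def scalar_prod_def atLeast0LessThan)
    also have "\<dots> = (\<Sum>x\<in>UNIV. psi (?v i * x) * (psi (- (x * ?v j)) / of_nat ?q))"
      by (rule sum_vertices)
    also have "\<dots> = (\<Sum>x\<in>UNIV. psi ((?v i - ?v j) * x)) / of_nat ?q"
      by (simp add: sum_divide_distrib mult.commute[of _ "?v j"] left_diff_distrib flip: psi_add)
    also have "\<dots> = (if i = j then 1 else 0)"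
      using ij by (simp add: sum_psi vertex_eq)
    finally show "(P * Q) $$ (i, j) = (1\<^sub>m ?q) $$ (i, j)"
      using ij by simp
  qed (use carrier in auto)
  have QP: "Q * P = 1\<^sub>m ?q"
    using mat_mult_left_right_inverse[OF carrier(1,2) PQ] .
  have AP: "?A * P = P * D"
  proof (rule eq_matI)
    fix i j assume "i < dim_row (P * D)" "j < dim_col (P * D)"
    then have ij: "i < ?q" "j < ?q" using carrier by auto
    have "(?A * P) $$ (i, j) = (\<Sum>l<?q. (if ?v l - ?v i \<in> S then 1 else 0) * psi (?v l * ?v j))"
      using ij by (simp add: P_def adjacency_matrix_def scalar_prod_def atLeast0LessThan)
    also have "\<dots> = (\<Sum>x\<in>UNIV. (if x - ?v i \<in> S then 1 else 0) * psi (x * ?v j))"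
      by (rule sum_vertices)
    also have "\<dots> = (\<Sum>s\<in>UNIV. (if s \<in> S then 1 else 0) * psi ((?v i + s) * ?v j))"
      by (rule sum.reindex_bij_witness[where i = "\<lambda>s. ?v i + s" and j = "\<lambda>x. x - ?v i"]) auto
    also have "\<dots> = (\<Sum>s\<in>UNIV. if s \<in> S then psi (?v i * ?v j) * psi (?v j * s) else 0)"
      by (rule sum.cong) (auto simp: mult.commute[of _ "?v j"] distrib_left psi_add)
    also have "\<dots> = psi (?v i * ?v j) * cayley_eigenvalue S (?v j)"
      by (simp add: cayley_eigenvalue_def sum_distrib_left flip: sum.inter_restrict)
    also have "\<dots> = (\<Sum>l<?q. psi (?v i * ?v l) * (if l = j then cayley_eigenvalue S (?v l) else 0))"
      using ij by (simp add: if_distrib cong: if_cong)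
    also have "\<dots> = (P * D) $$ (i, j)"
      using ij by (simp add: P_def D_def scalar_prod_def atLeast0LessThan)
    finally show "(?A * P) $$ (i, j) = (P * D) $$ (i, j)" .
  qed (use carrier in \<open>auto simp: adjacency_matrix_def\<close>)
  have A: "?A \<in> carrier_mat ?q ?q" by simp
  have "?A = ?A * (P * Q)" using right_mult_one_mat[OF A] PQ by simp
  also have "\<dots> = P * D * Q"
    using assoc_mult_mat[OF A carrier(1,2)] AP by simp
  finally have "similar_mat ?A D"
    using A carrier PQ QP by (intro similar_matI[where n = ?q and P = P and Q = Q]) auto
  then have "char_poly ?A = char_poly D" by (rule char_poly_similar)
  moreover have "upper_triangular D" by (auto simp: D_def upper_triangular_def)
  ultimately have "graph_spectrum (\<lambda>v w. w - v \<in> S) = mset (diag_mat D)"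
    using carrier spectrum_upper_triangular by (simp add: graph_spectrum_def)
  also have "diag_mat D = map (\<lambda>i. cayley_eigenvalue S (?v i)) [0..<?q]"
    by (auto simp: diag_mat_def D_def intro!: map_cong)
  also have "mset \<dots> = image_mset (cayley_eigenvalue S) (image_mset ?v (mset_set {..<?q}))"
    by (simp add: multiset.map_comp comp_def atLeast0LessThan flip: mset_set_upto_eq_mset_upto)
  also have "image_mset ?v (mset_set {..<?q}) = mset_set UNIV"
    using bij_betw_vertices[where ?'v = 'a] by (simp add: image_mset_mset_set bij_betw_def)
  finally show ?thesis .
qed

lemma energy_cayley: "energy (\<lambda>v w. w - v \<in> S) = (\<Sum>a\<in>UNIV. cmod (cayley_eigenvalue S a))"
  by (simp add: energy_def graph_spectrum_cayley multiset.map_comp comp_def sum_unfold_sum_mset)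

lemma eigenvalue_cayley_iff:
  "eigenvalue (adjacency_matrix (\<lambda>v w. w - v \<in> S)) \<mu> \<longleftrightarrow> \<mu> \<in> range (cayley_eigenvalue S)"
proof -
  let ?A = "adjacency_matrix (\<lambda>v w :: 'a. w - v \<in> S)"
  have "char_poly ?A \<noteq> 0"
    using degree_monic_char_poly[OF adjacency_matrix_carrier] by (metis coeff_0 zero_neq_one)
  then have "eigenvalue ?A \<mu> \<longleftrightarrow> \<mu> \<in># graph_spectrum (\<lambda>v w. w - v \<in> S)"
    unfolding eigenvalue_root_char_poly[OF adjacency_matrix_carrier] graph_spectrum_def
    by (simp add: set_count_proots)
  then show ?thesis by (simp add: graph_spectrum_cayley)
qed

end

section \<open>Gaussian periods\<close>

lemma of_nat_power_prime:
  assumes "prime p" "CHAR('a::comm_ring_1) = p"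
  shows "(of_nat j :: 'a) ^ p = of_nat j"
proof -
  have "prime CHAR('a)" "p = CHAR('a)" using assms by auto
  from freshmans_dream_sum[OF this, of "\<lambda>_. 1" "{..<j}"] show ?thesis by simp
qed

definition zeta :: "nat \<Rightarrow> complex" where "zeta p = cis (2 * pi / real p)"

lemma bij_betw_zeta_powers:
  assumes "p > 0"
  shows "bij_betw (\<lambda>j. zeta p ^ j) {..<p} {z. z ^ p = 1}"
  using bij_betw_roots_unity[OF assms] by (simp add: zeta_def DeMoivre mult_ac)

lemma zeta_power_mod:
  assumes "p > 0"
  shows "zeta p ^ (j mod p) = zeta p ^ j"
proof -
  have "zeta p ^ p = 1" using assms by (simp add: zeta_def DeMoivre)
  then have "zeta p ^ (p * (j div p) + j mod p) = zeta p ^ (j mod p)"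
    by (simp only: power_add power_mult power_one mult_1)
  then show ?thesis by simp
qed

text \<open>The character is \<open>zeta p\<close> raised to the absolute trace. The trace takes
  values in the prime field, being fixed by the Frobenius map, and is not identically zero because
  it is a nonzero polynomial of degree below \<open>CARD('a)\<close>.\<close>

lemma ex_additive_character:
  assumes p: "prime p" and card: "CARD('a::{field,finite}) = p ^ m"
  shows "\<exists>psi :: 'a \<Rightarrow> complex. additive_character psi"
proof -
  have char: "CHAR('a) = p" by (rule CHAR_eq_prime_of_card[OF p card])
  have p1: "p > 1" using p prime_gt_1_nat by blast
  have m: "m > 0"
    using card one_less_card_field[where ?'a = 'a] by (auto intro: Nat.gr0I)
  let ?K = "of_nat ` {..<p} :: 'a set"
  \<comment> \<open>The \<open>p\<close> elements of \<open>?K\<close> already exhaust the roots of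
    \<open>x ^ p = x\<close>.\<close>
  have K: "x \<in> ?K" if "x ^ p = x" for x :: 'a
  proof -
    define f where "f = monom (1::'a) p - monom 1 1"
    have "poly.coeff f p = 1" using p1 by (simp add: f_def)
    then have "f \<noteq> 0" by auto
    have "degree f \<le> p"
      unfolding f_def using p1 by (intro degree_diff_le) (auto simp: degree_monom_eq)
    then have "card {x. poly f x = 0} \<le> p"
      using card_poly_roots_bound[OF \<open>f \<noteq> 0\<close>] by simp
    moreover have sub: "?K \<subseteq> {x. poly f x = 0}"
      using of_nat_power_prime[OF p char] by (auto simp: f_def poly_monom)
    moreover have "inj_on (of_nat :: nat \<Rightarrow> 'a) {..<p}"
      by (auto simp: inj_on_def of_nat_eq_iff_cong_CHAR char cong_def)
    then have "card ?K = p" by (simp add: card_image)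
    ultimately have "?K = {x. poly f x = 0}"
      using card_mono[OF _ sub] by (intro card_subset_eq) auto
    then show ?thesis using that by (simp add: f_def poly_monom)
  qed
  define tr :: "'a \<Rightarrow> 'a" where "tr x = (\<Sum>i<m. x ^ (p ^ i))" for x
  have tr_add: "tr (x + y) = tr x + tr y" for x y
    unfolding tr_def using p char by (simp add: freshmans_dream' sum.distrib)
  have "tr x ^ p = tr x" for x
  proof -
    \<comment> \<open>Frobenius shifts the summands by one, and \<open>x ^ (p ^ m) = x\<close>
      closes the cycle.\<close>
    have "tr x ^ p = (\<Sum>i<m. x ^ (p ^ Suc i))"
      unfolding tr_def using p char by (simp add: freshmans_dream_sum mult.commute flip: power_mult)
    moreover have "x ^ (p ^ m) = x"
      using power_card_minus_one_eq_one[of x] power_minus_mult[of "CARD('a)" x] by (cases "x = 0") (auto simp flip: card)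
    ultimately have "tr x ^ p + x = tr x + x"
      unfolding tr_def using sum.lessThan_Suc_shift[of "\<lambda>i. x ^ (p ^ i)" m] by simp
    then show ?thesis by simp
  qed
  then have "\<exists>j<p. tr x = of_nat j" for x
    using K[of "tr x"] by blast
  then obtain h where h: "tr x = of_nat (h x)" "h x < p" for x by metis
  define psi where "psi x = zeta p ^ h x" for x
  have "psi (x + y) = psi x * psi y" for x y
  proof -
    \<comment> \<open>The representatives \<open>h\<close> are additive only modulo
      \<open>p\<close>, which is all that powers of \<open>zeta p\<close> see.\<close>
    have "of_nat (h (x + y)) = (of_nat (h x + h y) :: 'a)"
      using tr_add by (simp flip: h)
    then have "h (x + y) mod p = (h x + h y) mod p"
      unfolding of_nat_eq_iff_cong_CHAR char cong_def .
    moreover have "p > 0" using p1 by simp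
    ultimately have "psi (x + y) = zeta p ^ (h x + h y)"
      unfolding psi_def by (metis zeta_power_mod)
    then show ?thesis by (simp add: psi_def power_add)
  qed
  moreover have "psi x = 1 \<longleftrightarrow> tr x = 0" for x
  proof -
    have "psi x = 1 \<longleftrightarrow> zeta p ^ h x = zeta p ^ 0" by (simp add: psi_def)
    also have "\<dots> \<longleftrightarrow> h x = 0"
      using bij_betw_imp_inj_on[OF bij_betw_zeta_powers] p1 h(2)[of x]
      by (intro inj_on_eq_iff[where A = "{..<p}"]) auto
    also have "\<dots> \<longleftrightarrow> tr x = 0"
      using h[of x] by (auto simp: of_nat_eq_0_iff_char_dvd char dest: dvd_imp_le)
    finally show ?thesis .
  qed
  moreover have "\<exists>x. tr x \<noteq> 0"
  proof (rule ccontr)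
    assume "\<not> ?thesis"
    then have "{x. poly (\<Sum>i<m. monom 1 (p ^ i)) x = (0::'a)} = UNIV"
      by (simp add: tr_def poly_sum poly_monom)
    define f where "f = (\<Sum>i<m. monom (1::'a) (p ^ i))"
    have "poly.coeff f (p ^ 0) = (\<Sum>i<m. if i = 0 then 1 else 0)"
      unfolding f_def coeff_sum using p1 by (intro sum.cong) auto
    then have "f \<noteq> 0" using m by auto
    have "degree f \<le> p ^ (m - 1)"
      unfolding f_def
    proof (rule degree_sum_le)
      fix i assume "i \<in> {..<m}"
      then have "p ^ i \<le> p ^ (m - 1)" using p1 by (intro power_increasing) auto
      then show "degree (monom (1::'a) (p ^ i)) \<le> p ^ (m - 1)"
        by (simp add: degree_monom_eq)
    qed simp
    moreover have "p ^ (m - 1) < p ^ m"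
      using p1 m by (intro power_strict_increasing) auto
    moreover have "CARD('a) \<le> degree f"
      using card_poly_roots_bound[OF \<open>f \<noteq> 0\<close>]
        \<open>{x. poly (\<Sum>i<m. monom 1 (p ^ i)) x = 0} = UNIV\<close> by (simp add: f_def)
    ultimately show False using card by simp
  qed
  moreover have "tr 0 = 0"
    using p1 by (simp add: tr_def)
  ultimately have "additive_character psi"
    by unfold_locales auto
  then show ?thesis by blast
qed

section \<open>Integer consequences of the moment identities\<close>

text \<open>Here \<open>x\<close> is the period shared by two cosets, \<open>z\<close> that of the
  third, and \<open>T\<close> the number of consecutive cubic residues; the assumptions are the
  first three moments, and \<open>3 * n + 1\<close> is the order of the field.\<close>

lemma cubic_period_relation:
  fixes x z n T :: int
  assumes n: "n > 0"
    and m1: "n + n * (2 * x + z) = 0"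
    and m2: "n * n + n * (2 * (x * x) + z * z) = (3 * n + 1) * n"
    and m3: "n * n * n + n * (2 * (x * x * x) + z * z * z) = (3 * n + 1) * (n * T)"
  obtains s where "s\<^sup>2 = 3 * n + 1" "9 * T + 8 = s * (s - 2)"
proof -
  \<comment> \<open>Once \<open>z\<close> is eliminated, completing the square in the second moment
    gives this square root of \<open>3 * n + 1\<close>.\<close>
  define s where "s = 3 * x + 1"
  have "n * (1 + (2 * x + z)) = 0" using m1 by (simp add: distrib_left)
  then have z: "z = - 1 - 2 * x" using n by simp
  have "n * (n + (2 * (x * x) + z * z)) = n * (3 * n + 1)"
    using m2 by (simp add: distrib_left mult.commute)
  then have "n + (2 * (x * x) + z * z) = 3 * n + 1" using n by simp
  then have s2: "s\<^sup>2 = 3 * n + 1"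
    unfolding s_def z by (simp add: power2_eq_square algebra_simps)
  have "n * (n * n + (2 * (x * x * x) + z * z * z)) = n * ((3 * n + 1) * T)"
    using m3 by (simp add: distrib_left mult_ac)
  then have "n * n + (2 * (x * x * x) + z * z * z) = (3 * n + 1) * T" using n by simp
  \<comment> \<open>The factor 27 clears the denominators of \<open>x = (s - 1) / 3\<close> and
    \<open>n = (s\<^sup>2 - 1) / 3\<close>.\<close>
  then have "27 * ((3 * n + 1) * T) = 27 * (n * n + (2 * (x * x * x) + z * z * z))" by simp
  also have "\<dots> = 3 * ((3 * n) * (3 * n)) + 2 * ((3 * x) ^ 3) + (- 3 - 2 * (3 * x)) ^ 3"
    unfolding z by (simp add: power3_eq_cube algebra_simps)
  also have "3 * n = s\<^sup>2 - 1" using s2 by simp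
  also have "3 * x = s - 1" by (simp add: s_def)
  finally have "s\<^sup>2 * (27 * T) = s\<^sup>2 * (3 * s\<^sup>2 - 6 * s - 24)"
    by (simp add: power2_eq_square power3_eq_cube algebra_simps)
  moreover have "s\<^sup>2 \<noteq> 0" using s2 n by simp
  ultimately have "27 * T = 3 * s\<^sup>2 - 6 * s - 24" by (simp only: mult_cancel_left) auto
  then have "9 * T + 8 = s * (s - 2)"
    by (simp add: power2_eq_square algebra_simps)
  then show ?thesis using that s2 by blast
qed

text \<open>The pairs \<open>e0\<close>, \<open>e2\<close> and \<open>e1\<close>, \<open>e3\<close>
  are the periods in the two square classes. The mixed moment \<open>m2'\<close> correlates the
  members of a pair, and \<open>m3\<close> weights the squared periods by the pair sums. By
  \<open>eq\<close>, the coincidence lies within a pair or across the pairs.\<close>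

lemma quartic_period_relation:
  fixes e0 e1 e2 e3 n T :: int
  assumes n: "n > 0"
    and m1: "n + n * (e0 + e2 + e1 + e3) = 0"
    and m2: "n * n + n * (e0 * e0 + e2 * e2 + e1 * e1 + e3 * e3) = (4 * n + 1) * n"
    and m2': "n * n + n * (2 * (e0 * e2) + 2 * (e1 * e3)) = 0"
    and m3: "n * n * (2 * n) + n * (e0 * e0 * (e0 + e2) + e2 * e2 * (e0 + e2)
      + e1 * e1 * (e1 + e3) + e3 * e3 * (e1 + e3)) = (4 * n + 1) * (n * T)"
    and eq: "e0 = e2 \<or> e0 = e1"
  obtains s where "s\<^sup>2 = 4 * n + 1" "8 * T + 7 = s * (s - 2) \<or> 8 * T + 7 = s * (s + 2)"
proof -
  \<comment> \<open>The pair sums are \<open>(U - 1) / 2\<close> and \<open>- (U + 1) / 2\<close>,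
    so that \<open>U\<close> is a square root of the order of the field; \<open>D\<close> and
    \<open>E\<close> are the differences within the pairs.\<close>
  define U D E where "U = 2 * (e0 + e2) + 1" and "D = e0 - e2" and "E = e1 - e3"
  have "n * (1 + (e0 + e2 + e1 + e3)) = 0" using m1 by (simp add: distrib_left)
  then have e3: "e3 = - 1 - e0 - e2 - e1" using n by simp
  have "n * (n + (e0 * e0 + e2 * e2 + e1 * e1 + e3 * e3)) = n * (4 * n + 1)"
    using m2 by (simp add: distrib_left mult.commute)
  then have m2: "n + (e0 * e0 + e2 * e2 + e1 * e1 + e3 * e3) = 4 * n + 1" using n by simp
  have "n * (n + (2 * (e0 * e2) + 2 * (e1 * e3))) = 0"
    using m2' by (simp add: distrib_left)
  then have m2': "n + (2 * (e0 * e2) + 2 * (e1 * e3)) = 0" using n by simp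
  have "n * (2 * (n * n) + ((e0 * e0 + e2 * e2) * (e0 + e2) + (e1 * e1 + e3 * e3) * (e1 + e3)))
      = n * n * (2 * n) + n * (e0 * e0 * (e0 + e2) + e2 * e2 * (e0 + e2)
      + e1 * e1 * (e1 + e3) + e3 * e3 * (e1 + e3))"
    by (simp add: algebra_simps)
  also have "\<dots> = n * ((4 * n + 1) * T)"
    unfolding m3 by (simp only: mult.left_commute)
  finally have "n * (2 * (n * n) + ((e0 * e0 + e2 * e2) * (e0 + e2) + (e1 * e1 + e3 * e3) * (e1 + e3)))
      = n * ((4 * n + 1) * T)" .
  then have m3: "2 * (n * n) + ((e0 * e0 + e2 * e2) * (e0 + e2) + (e1 * e1 + e3 * e3) * (e1 + e3))
      = (4 * n + 1) * T" using n by simp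
  have U2: "U\<^sup>2 = 4 * n + 1"
    using m2 m2' unfolding U_def e3 by (simp add: power2_eq_square algebra_simps)
  have DE: "D * D + E * E = U\<^sup>2"
    using m2 m2' unfolding U2 D_def E_def by (simp add: algebra_simps)
  have "16 * ((4 * n + 1) * T)
      = 16 * (2 * (n * n) + ((e0 * e0 + e2 * e2) * (e0 + e2) + (e1 * e1 + e3 * e3) * (e1 + e3)))"
    using m3 by simp
  also have "\<dots> = 2 * ((4 * n) * (4 * n)) + (U - 1) * ((U - 1) * (U - 1) + 4 * (D * D))
      - (U + 1) * ((U + 1) * (U + 1) + 4 * (E * E))"
    unfolding U_def D_def E_def e3 by (simp add: algebra_simps)
  also have "4 * n = U\<^sup>2 - 1" using U2 by simp
  finally have m: "U\<^sup>2 * (16 * T) = 2 * ((U\<^sup>2 - 1) * (U\<^sup>2 - 1)) + (U - 1) * ((U - 1) * (U - 1) + 4 * (D * D))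
      - (U + 1) * ((U + 1) * (U + 1) + 4 * (E * E))"
    by simp
  \<comment> \<open>A coincidence across the pairs gives \<open>E - D = U\<close>; together with
    \<open>D * D + E * E = U\<^sup>2\<close> this forces \<open>D * E = 0\<close>, so some pair has
    equal members in either case.\<close>
  have "D = 0 \<or> E = 0"
  proof (cases "e0 = e2")
    case True
    then show ?thesis by (simp add: D_def)
  next
    case False
    then have "E - D = U" using eq by (simp add: U_def D_def E_def e3)
    then have "D * D + E * E = (E - D) * (E - D)" using DE by (simp add: power2_eq_square)
    then have "D * E = 0" by (simp add: algebra_simps)
    then show ?thesis by simp
  qed
  then have "U\<^sup>2 * (16 * T) = U\<^sup>2 * (2 * U\<^sup>2 - 14 - 4 * U) \<or> U\<^sup>2 * (16 * T) = U\<^sup>2 * (2 * U\<^sup>2 - 14 + 4 * U)"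
  proof
    assume D: "D = 0"
    then have E: "E * E = U * U" using DE by (simp add: power2_eq_square)
    show ?thesis using m unfolding D E by (simp add: power2_eq_square algebra_simps)
  next
    assume E: "E = 0"
    then have D: "D * D = U * U" using DE by (simp add: power2_eq_square)
    show ?thesis using m unfolding D E by (simp add: power2_eq_square algebra_simps)
  qed
  moreover have "U\<^sup>2 \<noteq> 0" using U2 n by simp
  ultimately have "16 * T = 2 * U\<^sup>2 - 14 - 4 * U \<or> 16 * T = 2 * U\<^sup>2 - 14 + 4 * U"
    by (simp only: mult_cancel_left) auto
  then have "8 * T + 7 = U * (U - 2) \<or> 8 * T + 7 = U * (U + 2)"
    by (auto simp: power2_eq_square algebra_simps)
  then show ?thesis using that U2 by blast
qed

text \<open>For \<open>k\<close> equal to 3 or 4, \<open>k_dvd\<close> expresses that the pair is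
  not semiprimitive. The condition \<open>p_dvd\<close> restates that \<open>k\<close> divides
  \<open>(q - 1) / (p - 1)\<close>, and places the units of the prime field in the group of
  \<open>k\<close>-th powers.\<close>

locale gaussian_periods = additive_character psi
  for psi :: "'a::{field,finite} \<Rightarrow> complex" +
  fixes p m k n :: nat
  assumes prime: "prime p" and card: "CARD('a) = p ^ m"
    and kn: "k * n = CARD('a) - 1"
    and k: "k > 1"
    and k_dvd: "k dvd p - 1"
    and p_dvd: "p - 1 dvd n"
begin

text \<open>The defining equation makes closure and counting computations with powers;
  \<open>R_eq\<close> identifies the set with the \<open>k\<close>-th powers.\<close>

definition R :: "'a set" where "R = {x. x ^ n = 1}"

abbreviation eta :: "'a \<Rightarrow> complex" where "eta \<equiv> cayley_eigenvalue R"

lemma char: "CHAR('a) = p"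
  by (rule CHAR_eq_prime_of_card[OF prime card])

lemma p1: "p > 1"
  using prime prime_gt_1_nat by blast

lemma n0: "n > 0"
  using kn one_less_card_field[where ?'a = 'a] by (auto intro!: Nat.gr0I)

lemma card_eq: "CARD('a) = k * n + 1"
  using kn by simp

lemma R_eq: "R = power_residues k" and card_R: "card R = n"
  using power_residues_eq[OF kn] by (simp_all add: R_def)

lemma zero_notin_R [simp]: "0 \<notin> R"
  using n0 by (simp add: R_def power_0_left)

lemma R_mult: "x \<in> R \<Longrightarrow> y \<in> R \<Longrightarrow> x * y \<in> R"
  by (simp add: R_def power_mult_distrib)

lemma R_inverse: "x \<in> R \<Longrightarrow> inverse x \<in> R"
  by (simp add: R_def power_inverse)

text \<open>Units of the prime field satisfy \<open>x ^ (p - 1) = 1\<close>, and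
  \<open>p - 1\<close> divides \<open>n\<close>.\<close>

lemma of_nat_in_R:
  assumes "\<not> p dvd j"
  shows "(of_nat j :: 'a) \<in> R"
proof -
  have nz: "(of_nat j :: 'a) \<noteq> 0"
    using assms by (simp add: of_nat_eq_0_iff_char_dvd char)
  have "(of_nat j :: 'a) ^ p = of_nat j"
    by (rule of_nat_power_prime[OF prime char])
  moreover have "(of_nat j :: 'a) ^ p = of_nat j * of_nat j ^ (p - 1)"
    using p1 by (cases p) auto
  ultimately have "(of_nat j :: 'a) ^ (p - 1) = 1" using nz by simp
  moreover obtain c where "n = (p - 1) * c" using p_dvd by (elim dvdE)
  ultimately have "(of_nat j :: 'a) ^ n = 1" by (simp add: power_mult)
  then show ?thesis by (simp add: R_def)
qed

lemma minus_one_in_R: "- 1 \<in> R"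
proof -
  have "of_nat (p - 1) = (of_nat p - 1 :: 'a)"
    using p1 by (simp add: of_nat_diff)
  also have "of_nat p = (0 :: 'a)"
    by (simp add: of_nat_eq_0_iff_char_dvd char)
  finally have eq: "of_nat (p - 1) = (- 1 :: 'a)" by simp
  have "\<not> p dvd p - 1" using p1 by (auto dest: dvd_imp_le)
  from of_nat_in_R[OF this] show ?thesis by (simp only: eq)
qed

lemma uminus_in_R:
  assumes "x \<in> R"
  shows "- x \<in> R"
  using R_mult[OF minus_one_in_R assms] by simp

lemma uminus_in_R_iff [simp]: "- x \<in> R \<longleftrightarrow> x \<in> R"
  using uminus_in_R[of x] uminus_in_R[of "- x"] by auto

lemma eta_mult:
  assumes "c \<in> R"
  shows "eta (c * a) = eta a"
proof -
  have c: "c \<noteq> 0" using assms zero_notin_R by blast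
  show ?thesis
    unfolding cayley_eigenvalue_def
  proof (rule sum.reindex_bij_witness[where i = "\<lambda>x. inverse c * x" and j = "\<lambda>x. c * x"])
    fix x assume "x \<in> R"
    then show "c * x \<in> R" "inverse c * x \<in> R"
      using assms R_mult R_inverse by simp_all
    show "psi (a * (c * x)) = psi (c * a * x)"
      by (simp only: mult_ac)
  qed (use c in \<open>simp_all flip: mult.assoc\<close>)
qed

section \<open>Integrality and nonvanishing of the periods\<close>

lemma psi_of_nat_mult: "psi (of_nat j * x) = psi x ^ j"
  by (induction j) (auto simp: distrib_right psi_add)

lemma psi_power_p: "psi x ^ p = 1"
  using psi_of_nat_mult[of p x] of_nat_CHAR[where ?'a = 'a] char by simp

definition level :: "complex \<Rightarrow> 'a \<Rightarrow> nat" where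
  "level w a = card {x \<in> R. psi (a * x) = w}"

text \<open>Scaling by the element \<open>j\<close> of the prime field permutes \<open>R\<close> and raises the values of \<open>psi\<close> to
  the power \<open>j\<close>; hence all nontrivial levels have the same size, and the period is an integer.\<close>

lemma level_le_level_power:
  assumes "\<not> p dvd j"
  shows "level w a \<le> level (w ^ j) a"
  unfolding level_def
proof (rule card_inj_on_le)
  have j: "(of_nat j :: 'a) \<in> R" by (rule of_nat_in_R[OF assms])
  then have "(of_nat j :: 'a) \<noteq> 0" using zero_notin_R by metis
  then show "inj_on (\<lambda>x. of_nat j * x) {x \<in> R. psi (a * x) = w}"
    by (auto simp: inj_on_def)
  show "(\<lambda>x. of_nat j * x) ` {x \<in> R. psi (a * x) = w} \<subseteq> {x \<in> R. psi (a * x) = w ^ j}"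
    using j R_mult by (auto simp: mult.left_commute[of a] psi_of_nat_mult)
qed simp

text \<open>Write \<open>w\<close> as the \<open>j\<close>-th power of \<open>zeta p\<close>;
  raising to \<open>j\<close> and to its inverse modulo \<open>p\<close> gives the two
  inequalities.\<close>

lemma level_eq_level_zeta:
  assumes "w ^ p = 1" "w \<noteq> 1"
  shows "level w a = level (zeta p) a"
proof (rule antisym)
  obtain j where j: "j < p" "w = zeta p ^ j"
    using bij_betw_zeta_powers[of p] p1 assms(1) by (auto simp: bij_betw_def image_iff set_eq_iff)
  then have "j \<noteq> 0" using assms(2) by (auto intro: Nat.gr0I)
  then have nd: "\<not> p dvd j" using j by (auto dest: dvd_imp_le)
  then show "level (zeta p) a \<le> level w a"
    unfolding j by (rule level_le_level_power)
  have "coprime j p" using nd prime by (metis prime_imp_coprime coprime_commute)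
  then obtain i where i: "[j * i = 1] (mod p)" using cong_solve_coprime_nat[of j p] by auto
  have "\<not> p dvd i"
  proof
    assume "p dvd i"
    then have "[j * i = 0] (mod p)" by (simp add: cong_0_iff)
    then have "[0 = 1] (mod p)" using i by (metis cong_sym cong_trans)
    then show False using p1 by (simp add: cong_def)
  qed
  then have "level w a \<le> level (w ^ i) a" by (rule level_le_level_power)
  also have "w ^ i = zeta p ^ (j * i mod p)"
    using p1 by (simp add: j zeta_power_mod power_mult)
  also have "\<dots> = zeta p" using i p1 by (simp add: cong_def)
  finally show "level w a \<le> level (zeta p) a" .
qed

text \<open>With \<open>L\<close> the common size of the nontrivial levels, the level of 1 has size
  \<open>n - L * (p - 1)\<close> and the nontrivial roots of unity sum to -1, so the period is
  \<open>n - p * L\<close>.\<close>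

definition period :: "'a \<Rightarrow> int" where
  "period a = int n - int p * int (level (zeta p) a)"

lemma eta_eq_period: "eta a = of_int (period a)"
proof -
  let ?U = "{w :: complex. w ^ p = 1}" and ?L = "level (zeta p) a"
  have fin: "finite ?U" using p1 by (intro finite_roots_unity) auto
  \<comment> \<open>Used twice: a constant \<open>g\<close> yields the size of the level of 1, and
    the identity yields the period.\<close>
  have part: "(\<Sum>x\<in>R. g (psi (a * x))) = of_nat (level 1 a) * g 1 + of_nat ?L * (sum g ?U - g 1)"
    for g :: "complex \<Rightarrow> complex"
  proof -
    have "(\<Sum>x\<in>R. g (psi (a * x))) = (\<Sum>w\<in>?U. \<Sum>x\<in>{x \<in> R. psi (a * x) = w}. g (psi (a * x)))"
      using fin psi_power_p by (intro sum.group[symmetric]) auto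
    also have "\<dots> = (\<Sum>w\<in>?U. of_nat (level w a) * g w)"
      by (rule sum.cong) (simp_all add: level_def)
    also have "\<dots> = of_nat (level 1 a) * g 1 + (\<Sum>w\<in>?U - {1}. of_nat (level w a) * g w)"
      using fin by (simp add: sum.remove[of ?U 1])
    also have "(\<Sum>w\<in>?U - {1}. of_nat (level w a) * g w) = of_nat ?L * (\<Sum>w\<in>?U - {1}. g w)"
      unfolding sum_distrib_left by (rule sum.cong) (auto simp: level_eq_level_zeta)
    also have "(\<Sum>w\<in>?U - {1}. g w) = sum g ?U - g 1"
      using fin by (simp add: sum_diff1)
    finally show ?thesis .
  qed
  have "(of_nat n :: complex) = of_nat (level 1 a) + of_nat ?L * (of_nat p - 1)"
    using part[of "\<lambda>_. 1"] p1 card_roots_unity_eq[of p] by (simp add: card_R)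
  then have level_1: "of_nat (level 1 a) = (of_nat n - of_nat ?L * (of_nat p - 1) :: complex)"
    by (simp only: eq_diff_eq)
  have "eta a = of_nat (level 1 a) - of_nat ?L"
    using part[of "\<lambda>w. w"] p1 sum_roots_unity[of p] by (simp add: cayley_eigenvalue_def)
  also have "\<dots> = of_nat n - of_nat ?L * (of_nat p - 1) - of_nat ?L"
    by (simp only: level_1)
  also have "\<dots> = of_int (period a)"
    by (simp add: period_def algebra_simps)
  finally show ?thesis .
qed

lemma period_mult: "c \<in> R \<Longrightarrow> period (c * a) = period a"
  using eta_mult[of c a] by (simp add: eta_eq_period)

lemma period_0: "period 0 = int n"
proof -
  have "eta 0 = of_nat n" by (simp add: cayley_eigenvalue_def card_R)
  then have "of_int (period 0) = (of_int (int n) :: complex)" by (simp add: eta_eq_period)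
  then show ?thesis by (simp only: of_int_eq_iff)
qed

lemma p_dvd_card: "p dvd CARD('a)"
  using card one_less_card_field[where ?'a = 'a] by (cases m) auto

text \<open>The period is congruent to \<open>n\<close> modulo \<open>p\<close>, and
  \<open>p\<close> cannot divide \<open>n\<close> because
  \<open>k * n = CARD('a) - 1\<close>.\<close>

lemma period_nonzero: "period a \<noteq> 0"
proof
  assume "period a = 0"
  then have "int n = int (p * level (zeta p) a)" by (simp add: period_def)
  then have "n = p * level (zeta p) a" by (simp only: of_nat_eq_iff)
  then have "p dvd k * n" by (metis dvd_mult dvd_triv_left)
  then have "p dvd 1" using p_dvd_card card_eq by (metis dvd_add_right_iff)
  then show False using p1 by simp
qed

section \<open>Moments of the periods\<close>

text \<open>Orthogonality turns a threefold product of character sums into a count of zero-sum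
  triples. The set \<open>{0}\<close> has constant character sum 1, so the lower moments are
  included.\<close>

lemma sum_period_product:
  assumes "finite I" "finite J" "finite K"
    and "\<And>a. of_int (f a) = (\<Sum>x\<in>I. psi (a * x))"
    and "\<And>a. of_int (g a) = (\<Sum>x\<in>J. psi (a * x))"
    and "\<And>a. of_int (h a) = (\<Sum>x\<in>K. psi (a * x))"
  shows "(\<Sum>a\<in>UNIV. f a * g a * h a)
    = int (CARD('a) * card {(x, y, z). x \<in> I \<and> y \<in> J \<and> z \<in> K \<and> x + y + z = 0})"
proof -
  have "sum F I * sum G J * sum H K
      = (\<Sum>t\<in>I \<times> J \<times> K. F (fst t) * (G (fst (snd t)) * H (snd (snd t))))" for F G H :: "'a \<Rightarrow> complex"
  proof -
    have eq: "sum G J * sum H K = (\<Sum>t\<in>J \<times> K. G (fst t) * H (snd t))"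
      by (simp only: sum_product sum.cartesian_product case_prod_unfold)
    have "sum F I * sum G J * sum H K = sum F I * (\<Sum>t\<in>J \<times> K. G (fst t) * H (snd t))"
      by (simp only: mult.assoc eq)
    then show ?thesis
      by (simp only: sum_product sum.cartesian_product case_prod_unfold)
  qed
  then have "of_int (\<Sum>a\<in>UNIV. f a * g a * h a)
      = (\<Sum>a\<in>UNIV. \<Sum>t\<in>I \<times> J \<times> K. psi (a * fst t) * (psi (a * fst (snd t)) * psi (a * snd (snd t))))"
    by (simp only: of_int_sum of_int_mult assms(4-6))
  also have "\<dots> = (\<Sum>a\<in>UNIV. \<Sum>t\<in>I \<times> J \<times> K. psi (a * (case t of (x, y, z) \<Rightarrow> x + y + z)))"
    by (simp only: case_prod_unfold distrib_left psi_add mult.assoc)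
  also have "\<dots> = of_nat (CARD('a) * card {t \<in> I \<times> J \<times> K. (case t of (x, y, z) \<Rightarrow> x + y + z) = 0})"
    using assms(1-3) by (intro sum_sum_psi) auto
  also have "{t \<in> I \<times> J \<times> K. (case t of (x, y, z) \<Rightarrow> x + y + z) = 0}
      = {(x, y, z). x \<in> I \<and> y \<in> J \<and> z \<in> K \<and> x + y + z = 0}"
    by auto
  finally show ?thesis
    unfolding of_int_of_nat_eq[where ?'a = complex, symmetric] of_int_eq_iff .
qed

lemma R_divide_swap: "y / x \<notin> R \<Longrightarrow> x / y \<notin> R"
  using R_inverse[of "x / y"] by auto

text \<open>\<open>Y\<close> is a transversal: its \<open>k\<close> disjoint cosets of size
  \<open>n\<close> exhaust the units.\<close>

lemma sum_over_cosets:
  fixes F :: "'a \<Rightarrow> int"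
  assumes "card Y = k" "0 \<notin> Y"
    and distinct: "\<And>x y. x \<in> Y \<Longrightarrow> y \<in> Y \<Longrightarrow> x \<noteq> y \<Longrightarrow> y / x \<notin> R"
    and F: "\<And>c a. c \<in> R \<Longrightarrow> F (c * a) = F a"
  shows "(\<Sum>a\<in>UNIV. F a) = F 0 + int n * (\<Sum>y\<in>Y. F y)"
proof -
  let ?C = "\<lambda>y. (\<lambda>c. c * y) ` R"
  have nz: "y \<noteq> 0" if "y \<in> Y" for y using that assms(2) by auto
  have card_C: "card (?C y) = n" if "y \<in> Y" for y
    using nz[OF that] by (subst card_image) (auto simp: inj_on_def card_R)
  have disj: "?C x \<inter> ?C y = {}" if xy: "x \<in> Y" "y \<in> Y" "x \<noteq> y" for x y
  proof -
    have False if "c \<in> R" "d \<in> R" "c * x = d * y" for c d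
    proof -
      have "d \<noteq> 0" using that(2) zero_notin_R by blast
      then have "y / x = c * inverse d"
        using that(3) nz xy by (simp add: field_simps)
      then show False using distinct[OF xy] R_mult R_inverse that by metis
    qed
    then show ?thesis by auto
  qed
  have "card (\<Union>y\<in>Y. ?C y) = (\<Sum>y\<in>Y. card (?C y))"
    using disj by (intro card_UN_disjoint) auto
  also have "\<dots> = card (UNIV - {0::'a})"
    using card_C assms(1) kn by (simp add: card_Diff_singleton)
  finally have "(\<Union>y\<in>Y. ?C y) = UNIV - {0}"
    using nz zero_notin_R by (intro card_subset_eq) auto
  then have "(\<Sum>a\<in>UNIV - {0}. F a) = (\<Sum>y\<in>Y. \<Sum>a\<in>?C y. F a)"
    using disj by (subst sum.UNION_disjoint[symmetric]) auto
  also have "\<dots> = (\<Sum>y\<in>Y. int n * F y)"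
  proof (rule sum.cong[OF refl])
    fix y assume "y \<in> Y"
    have "(\<Sum>a\<in>?C y. F a) = (\<Sum>a\<in>?C y. F y)"
      by (rule sum.cong) (auto simp: F)
    then show "(\<Sum>a\<in>?C y. F a) = int n * F y"
      using card_C[OF \<open>y \<in> Y\<close>] by simp
  qed
  finally show ?thesis
    by (simp add: sum.remove[of UNIV "0::'a"] sum_distrib_left)
qed

lemma period_eq_sum: "of_int (period a) = (\<Sum>x\<in>R. psi (a * x))"
  by (simp add: eta_eq_period[symmetric] cayley_eigenvalue_def)

lemma period_eq_sum_image:
  assumes "u \<noteq> 0"
  shows "of_int (period (u * a)) = (\<Sum>x\<in>(*) u ` R. psi (a * x))"
proof -
  have "inj_on ((*) u) R" using assms by (auto simp: inj_on_def)
  then have "(\<Sum>x\<in>(*) u ` R. psi (a * x)) = (\<Sum>x\<in>R. psi (a * (u * x)))"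
    by (simp add: sum.reindex)
  also have "\<dots> = (\<Sum>x\<in>R. psi (u * a * x))"
    by (simp only: mult_ac)
  finally show ?thesis by (simp only: period_eq_sum)
qed

lemma sum_period: "(\<Sum>a\<in>UNIV. period a) = 0"
proof -
  have "(\<Sum>a\<in>UNIV. period a * 1 * 1)
      = int (CARD('a) * card {(x, y, z). x \<in> R \<and> y \<in> {0::'a} \<and> z \<in> {0} \<and> x + y + z = 0})"
    by (rule sum_period_product) (simp_all add: period_eq_sum)
  also have "{(x, y, z). x \<in> R \<and> y \<in> {0::'a} \<and> z \<in> {0} \<and> x + y + z = 0} = {}"
    by auto
  finally show ?thesis by simp
qed

text \<open>The equation \<open>x + u * y = 0\<close> has solutions in \<open>R\<close> only if
  \<open>u\<close> is in \<open>R\<close>, as -1 is; then \<open>x\<close> is free and determines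
  \<open>y\<close>.\<close>

lemma sum_period_period:
  assumes "u \<noteq> 0"
  shows "(\<Sum>a\<in>UNIV. period a * period (u * a)) = (if u \<in> R then int (CARD('a) * n) else 0)"
proof -
  let ?Z = "{(x, y, z). x \<in> R \<and> y \<in> (*) u ` R \<and> z \<in> {0::'a} \<and> x + y + z = 0}"
  have "(\<Sum>a\<in>UNIV. period a * period (u * a) * 1) = int (CARD('a) * card ?Z)"
    by (rule sum_period_product[OF _ _ _ period_eq_sum period_eq_sum_image[OF assms]]) simp_all
  moreover have "card ?Z = (if u \<in> R then n else 0)"
  proof (cases "u \<in> R")
    case True
    have "- x \<in> (*) u ` R" if "x \<in> R" for x
    proof -
      have "- (inverse u * x) \<in> R" using True that R_mult R_inverse by simp
      then have "u * - (inverse u * x) \<in> (*) u ` R" by blast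
      then show ?thesis using assms by (simp flip: mult.assoc)
    qed
    then have "?Z = (\<lambda>x. (x, - x, 0)) ` R"
      by (auto simp: image_iff eq_neg_iff_add_eq_0 add.commute)
    then have "card ?Z = card R"
      by (simp add: card_image inj_on_def)
    then show ?thesis using True card_R by simp
  next
    case False
    have "?Z = {}"
    proof -
      have "u \<in> R" if "x \<in> R" "y \<in> R" "x + u * y = 0" for x y
      proof -
        have "y \<noteq> 0" using that(2) zero_notin_R by blast
        then have "u = - x * inverse y" using that(3) by (simp add: field_simps eq_neg_iff_add_eq_0)
        then show ?thesis using R_mult R_inverse that by simp
      qed
      then show ?thesis using False by auto
    qed
    then show ?thesis using False by simp
  qed
  ultimately show ?thesis by auto
qed

text \<open>A zero-sum triple is scaled by its first entry \<open>r\<close> to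
  \<open>(1, x, - (1 + x))\<close>, and \<open>r\<close> runs through the \<open>n\<close> elements
  of \<open>R\<close>. The case \<open>d = 1\<close> is the third moment of the periods;
  \<open>d = 2\<close> serves \<open>k = 4\<close>.\<close>

lemma sum_period_period_theta:
  assumes "\<And>a. of_int (theta a) = (\<Sum>x\<in>{x. x ^ (d * n) = 1}. psi (a * x))"
  shows "(\<Sum>a\<in>UNIV. period a * period a * theta a)
    = int (CARD('a) * (n * card {x::'a. x ^ n = 1 \<and> (1 + x) ^ (d * n) = 1}))"
proof -
  let ?S = "{x::'a. x ^ (d * n) = 1}"
  let ?T = "{x::'a. x ^ n = 1 \<and> (1 + x) ^ (d * n) = 1}"
  let ?Z = "{(x, y, z). x \<in> R \<and> y \<in> R \<and> z \<in> ?S \<and> x + y + z = 0}"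
  have "(\<Sum>a\<in>UNIV. period a * period a * theta a) = int (CARD('a) * card ?Z)"
    by (rule sum_period_product[OF _ _ _ period_eq_sum period_eq_sum assms]) simp_all
  moreover have "bij_betw (\<lambda>(r, x). (r, r * x, - r * (1 + x))) (R \<times> ?T) ?Z"
  proof (rule bij_betw_byWitness[where f' = "\<lambda>(x, y, z). (x, y / x)"])
    have nz: "x \<noteq> 0" if "x \<in> R" for x using that zero_notin_R by blast
    have S: "(- r * x) ^ (d * n) = 1 \<longleftrightarrow> x ^ (d * n) = 1" if "r \<in> R" for r x :: 'a
    proof -
      have "- r \<in> R" using that by simp
      then have "(- r) ^ (d * n) = 1" by (simp add: R_def mult.commute[of d] power_mult)
      then show ?thesis by (simp only: power_mult_distrib mult_1)
    qed
    have z: "- x * (1 + y / x) = z" if "x \<in> R" "x + y + z = 0" for x y z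
    proof -
      have "- x * (1 + y / x) = - (x + y)"
        using nz[OF that(1)] by (simp add: distrib_left)
      also have "\<dots> = z" using that(2) by (rule minus_unique)
      finally show ?thesis .
    qed
    show "\<forall>t\<in>R \<times> ?T. (case case t of (r, x) \<Rightarrow> (r, r * x, - r * (1 + x)) of (x, y, z) \<Rightarrow> (x, y / x)) = t"
      using nz by auto
    show "\<forall>t\<in>?Z. (case case t of (x, y, z) \<Rightarrow> (x, y / x) of (r, x) \<Rightarrow> (r, r * x, - r * (1 + x))) = t"
    proof
      fix t assume "t \<in> ?Z"
      moreover obtain x y w where "t = (x, y, w)" by (rule prod_cases3)
      ultimately have t: "t = (x, y, w)" "x \<in> R" "x + y + w = 0" by simp_all
      then show "(case case t of (x, y, z) \<Rightarrow> (x, y / x) of (r, x) \<Rightarrow> (r, r * x, - r * (1 + x))) = t"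
        using z[OF t(2,3)] nz[OF t(2)] by simp
    qed
    show "(\<lambda>(r, x). (r, r * x, - r * (1 + x))) ` (R \<times> ?T) \<subseteq> ?Z"
    proof
      fix t assume "t \<in> (\<lambda>(r, x). (r, r * x, - r * (1 + x))) ` (R \<times> ?T)"
      then obtain s where "s \<in> R \<times> ?T" "t = (\<lambda>(r, x). (r, r * x, - r * (1 + x))) s"
        by (rule imageE)
      moreover obtain r x where "s = (r, x)" by (rule prod.exhaust)
      ultimately have t: "t = (r, r * x, - r * (1 + x))" "r \<in> R" "x \<in> R" "(1 + x) ^ (d * n) = 1"
        by (simp_all add: R_def)
      have "r + r * x + - r * (1 + x) = 0" by (simp add: distrib_left)
      then show "t \<in> ?Z"
        using t(2,4) R_mult[OF t(2,3)] S[OF t(2), of "1 + x"] unfolding t(1) by (simp only: mem_Collect_eq case_prod_conv)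
    qed
    show "(\<lambda>(x, y, z). (x, y / x)) ` ?Z \<subseteq> R \<times> ?T"
    proof
      fix t assume "t \<in> (\<lambda>(x, y, z). (x, y / x)) ` ?Z"
      then obtain s where "s \<in> ?Z" "t = (\<lambda>(x, y, z). (x, y / x)) s"
        by (rule imageE)
      moreover obtain x y w where "s = (x, y, w)" by (rule prod_cases3)
      ultimately have t: "t = (x, y / x)" "x \<in> R" "y \<in> R" "w ^ (d * n) = 1" "x + y + w = 0"
        by simp_all
      have "(1 + y / x) ^ (d * n) = 1"
        using S[OF t(2), of "1 + y / x"] t(4) unfolding z[OF t(2,5)] by blast
      moreover have "(y / x) ^ n = 1"
        using t(2,3) by (simp add: R_def power_divide)
      ultimately show "t \<in> R \<times> ?T" using t by simp
    qed
  qed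
  then have "card (R \<times> ?T) = card ?Z"
    by (rule bij_betw_same_card)
  then have "card ?Z = n * card ?T"
    by (simp only: card_cartesian_product card_R)
  ultimately show ?thesis by (simp only:)
qed

section \<open>Different cosets have different periods\<close>

lemma p_not_dvd_central_binomial: "\<not> p dvd (2 * n choose n)"
proof (rule prime_not_dvd_central_binomial[OF prime k])
  show "[p = 1] (mod k)" using k_dvd p1 by (simp add: cong_altdef_nat)
  show "k * n = p ^ m - 1" using kn card by simp
qed

lemma p_dvd_square_root_card:
  assumes "s\<^sup>2 = int CARD('a)"
  shows "int p dvd s"
proof -
  have "int p dvd s\<^sup>2" using p_dvd_card assms by simp
  then show ?thesis using prime by (simp add: prime_dvd_power_iff)
qed

text \<open>If two cosets had the same period, the first three moments would force \<open>CARD('a)\<close> to be a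
  square and \<open>p\<close> to divide \<open>9 T + 8\<close>, where \<open>T\<close> counts consecutive residues; but modulo \<open>p\<close> this
  number is minus a central binomial coefficient.\<close>

lemma quotient_in_R_if_period_eq_cubic:
  assumes k3: "k = 3" and ab: "a \<noteq> 0" "b \<noteq> 0" and eq: "period a = period b"
  shows "b / a \<in> R"
proof (rule ccontr)
  assume nR: "b / a \<notin> R"
  have card_q: "CARD('a) = 3 * n + 1" using card_eq k3 by simp
  \<comment> \<open>Zero and two cosets leave room for a representative \<open>c\<close> of the
    third coset.\<close>
  have "card ({0} \<union> (\<lambda>c. c * a) ` R \<union> (\<lambda>c. c * b) ` R) \<le> 1 + n + n"
    using card_image_le[of R "\<lambda>c. c * a"] card_image_le[of R "\<lambda>c. c * b"]
    by (intro order_trans[OF card_Un_le] add_mono) (auto simp: card_R)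
  then have "{0} \<union> (\<lambda>c. c * a) ` R \<union> (\<lambda>c. c * b) ` R \<noteq> UNIV"
    using card_q n0 by auto
  then obtain c where c: "c \<noteq> 0" "c \<notin> (\<lambda>c. c * a) ` R" "c \<notin> (\<lambda>c. c * b) ` R" by auto
  have "c / a \<notin> R" "c / b \<notin> R"
    using c ab by (auto simp: image_iff)
  note nR = this nR and nR' = this[THEN R_divide_swap] nR[THEN R_divide_swap]
  have "1 \<in> R" by (simp add: R_def)
  then have distinct: "a \<noteq> b" "a \<noteq> c" "b \<noteq> c"
    using nR ab by auto
  have cosets: "(\<Sum>a\<in>UNIV. f (period a)) = f (int n) + int n * (2 * f (period a) + f (period c))" for f :: "int \<Rightarrow> int"
    using sum_over_cosets[of "{a, b, c}" "\<lambda>a. f (period a)"] distinct ab c(1) nR nR' k3 eq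
    by (auto simp: period_mult period_0)
  let ?T = "card {x::'a. x ^ n = 1 \<and> (1 + x) ^ n = 1}"
  have m1: "int n + int n * (2 * period a + period c) = 0"
    using cosets[of "\<lambda>x. x"] sum_period by simp
  have m2: "int n * int n + int n * (2 * (period a * period a) + period c * period c)
      = (3 * int n + 1) * int n"
    using cosets[of "\<lambda>x. x * x"] sum_period_period[of 1] \<open>1 \<in> R\<close>
    by (simp add: card_q distrib_right)
  have m3: "int n * int n * int n + int n * (2 * (period a * period a * period a) + period c * period c * period c)
      = (3 * int n + 1) * (int n * int ?T)"
  proof -
    have "of_int (period x) = (\<Sum>y\<in>{y. y ^ (1 * n) = 1}. psi (x * y))" for x
      by (simp add: period_eq_sum R_def)
    then have "(\<Sum>a\<in>UNIV. period a * period a * period a) = (3 * int n + 1) * (int n * ?T)"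
      using sum_period_period_theta[of period 1] by (simp add: card_q distrib_right)
    then show ?thesis
      using cosets[of "\<lambda>x. x * x * x"] by (simp only:)
  qed
  have "0 < int n" using n0 by simp
  then obtain s where s: "s\<^sup>2 = 3 * int n + 1" "9 * int ?T + 8 = s * (s - 2)"
    by (rule cubic_period_relation[OF _ m1 m2 m3])
  have "int p dvd s" using s(1) by (intro p_dvd_square_root_card) (simp add: card_q)
  then have "int p dvd 9 * int ?T + 8" unfolding s(2) by (rule dvd_mult2)
  then have "int p dvd int (9 * ?T + 8)" by simp
  then have "p dvd 9 * ?T + 8" by (simp only: of_nat_dvd_iff)
  moreover have "p dvd 9 * ?T + 8 + (2 * n choose n)"
  proof -
    have "(- 1 :: 'a) ^ n = 1"
      using minus_one_in_R by (simp only: R_def mem_Collect_eq)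
    moreover have "3 * n = CARD('a) - 1" using card_q by simp
    ultimately have "of_nat (9 * ?T + 8 + (2 * n choose n)) = (0 :: 'a)"
      by (rule card_consecutive_cubic_residues[rotated])
    then show ?thesis by (simp only: of_nat_eq_0_iff_char_dvd char)
  qed
  ultimately have "p dvd (2 * n choose n)" by (simp only: dvd_add_right_iff)
  then show False using p_not_dvd_central_binomial by contradiction
qed

text \<open>As in the cubic case, but the third moment is taken with one quadratic period
  \<open>theta\<close>, matching the count of \<open>x\<close> in \<open>R\<close> for which
  \<open>1 + x\<close> is a nonzero square.\<close>

lemma quotient_in_R_if_period_eq_quartic:
  assumes k4: "k = 4" and ab: "a \<noteq> 0" "b \<noteq> 0" and eq: "period a = period b"
  shows "b / a \<in> R"
proof (rule ccontr)
  assume nR: "b / a \<notin> R"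
  have card_q: "CARD('a) = 4 * n + 1" using card_eq k4 by simp
  let ?S = "{x::'a. x ^ (2 * n) = 1}"
  have card_S: "card ?S = 2 * n"
    using card_q by (intro power_residues_eq(2)[of 2]) simp
  have R_sub: "R \<subseteq> ?S"
  proof
    fix x assume "x \<in> R"
    then have "(x ^ n) ^ 2 = 1" by (simp only: R_def mem_Collect_eq power_one)
    then show "x \<in> ?S" by (simp only: mem_Collect_eq mult.commute[of 2 n] power_mult)
  qed
  have one: "1 \<in> R" by (simp add: R_def)
  have ex_u: "\<exists>u. u \<in> ?S \<and> u \<notin> R"
  proof (rule ccontr)
    assume "\<not> ?thesis"
    then have "?S \<subseteq> R" by blast
    then have "card ?S \<le> card R" by (rule card_mono[rotated]) (rule finite)
    then show False using n0 unfolding card_S card_R by simp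
  qed
  have "card (insert 0 ?S) \<le> Suc (2 * n)"
    using card_insert_le_m1[of "Suc (2 * n)" ?S] card_S by simp
  then have "insert 0 ?S \<noteq> UNIV" using card_q n0 by auto
  then have ex_v: "\<exists>v. v \<noteq> 0 \<and> v \<notin> ?S" by blast
  \<comment> \<open>\<open>u\<close> is a square outside \<open>R\<close> and \<open>v\<close> a
    nonsquare, so \<open>a\<close>, \<open>u * a\<close>, \<open>v * a\<close>,
    \<open>u * v * a\<close> represent all cosets; whichever kind \<open>b / a\<close> has, it is
    taken as \<open>u\<close> or \<open>v\<close>.\<close>
  obtain u v where uv: "u \<in> ?S" "u \<notin> R" "v \<noteq> 0" "v \<notin> ?S" "b = u * a \<or> b = v * a"
  proof (cases "b / a \<in> ?S")
    case True
    obtain v where "v \<noteq> 0" "v \<notin> ?S" using ex_v by blast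
    moreover have "b = b / a * a" using ab(1) by simp
    ultimately show ?thesis using that[of "b / a" v] True nR by blast
  next
    case False
    obtain u where "u \<in> ?S" "u \<notin> R" using ex_u by blast
    moreover have "b = b / a * a" "b / a \<noteq> 0" using ab by simp_all
    ultimately show ?thesis using that[of u "b / a"] False by blast
  qed
  have u0: "u \<noteq> 0"
  proof
    assume "u = 0"
    then have "(0::'a) ^ (2 * n) = 1" using uv(1) by simp
    then show False using n0 by (simp add: power_0_left)
  qed
  have "(u * u) ^ n = u ^ (2 * n)"
    by (simp only: power_mult power2_eq_square)
  then have uu: "u * u \<in> R"
    using uv(1) by (simp only: R_def mem_Collect_eq)
  have u_disj: "R \<inter> (*) u ` R = {}"
  proof -
    have "u \<in> R" if "d \<in> R" "u * d \<in> R" for d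
    proof -
      have "d \<noteq> 0" using that(1) zero_notin_R by blast
      then have "u = u * d * inverse d" by simp
      then show ?thesis using that R_mult R_inverse by metis
    qed
    then show ?thesis using uv(2) by blast
  qed
  have S_eq: "?S = R \<union> (*) u ` R"
  proof (rule card_subset_eq[symmetric])
    show "R \<union> (*) u ` R \<subseteq> ?S"
      using R_sub uv(1) by (auto simp: power_mult_distrib)
    have "inj_on ((*) u) R" using u0 by (auto simp: inj_on_def)
    then show "card (R \<union> (*) u ` R) = card ?S"
      using u_disj card_R by (simp add: card_Un_disjoint card_image card_S)
  qed simp
  have uR: "v \<noteq> u * c" if "c \<in> R" for c
    using uv(4) S_eq that by blast
  have vR: "v \<notin> R" using R_sub uv(4) by blast
  have vuR: "v / u \<notin> R" using uR[of "v / u"] u0 by auto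
  have uvR: "u * v \<notin> R"
  proof
    assume "u * v \<in> R"
    then have "u * v * inverse (u * u) \<in> R" using R_mult R_inverse uu by blast
    moreover have "v = u * (u * v * inverse (u * u))" using u0 by (simp add: field_simps)
    ultimately show False using uR by blast
  qed
  have cosets: "(\<Sum>x\<in>UNIV. F x) = F 0 + int n * (F a + F (u * a) + F (v * a) + F (u * v * a))"
    if F: "\<And>c x. c \<in> R \<Longrightarrow> F (c * x) = F x" for F :: "'a \<Rightarrow> int"
  proof -
    let ?Y = "{a, u * a, v * a, u * v * a}"
    have ne: "u \<noteq> 1" "v \<noteq> 1" "u * v \<noteq> 1" "u \<noteq> v"
      using uv(2) vR uvR vuR one u0 by auto
    then have card_Y: "card ?Y = 4"
      using ab(1) u0 uv(3) by auto
    have nots: "1 / u \<notin> R" "1 / v \<notin> R" "1 / (u * v) \<notin> R" "u / v \<notin> R"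
      using R_divide_swap[of u 1] R_divide_swap[of v 1] R_divide_swap[of "u * v" 1] R_divide_swap[of v u]
        uv(2) vR uvR vuR by auto
    have "(\<Sum>x\<in>UNIV. F x) = F 0 + int n * (\<Sum>y\<in>?Y. F y)"
    proof (rule sum_over_cosets)
      show "y / x \<notin> R" if "x \<in> ?Y" "y \<in> ?Y" "x \<noteq> y" for x y
        using that uv(2) vR uvR vuR nots ab(1) u0 uv(3) by auto
    qed (use card_Y k4 F ab(1) u0 uv(3) in auto)
    also have "(\<Sum>y\<in>?Y. F y) = F a + F (u * a) + F (v * a) + F (u * v * a)"
      using ne ab(1) u0 uv(3) by auto
    finally show ?thesis .
  qed
  \<comment> \<open>The quadratic period: the nonzero squares are the union of \<open>R\<close> and
    its translate by \<open>u\<close>.\<close>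
  define theta where "theta x = period x + period (u * x)" for x
  have theta: "of_int (theta x) = (\<Sum>y\<in>?S. psi (x * y))" for x
    unfolding theta_def of_int_add period_eq_sum_image[OF u0] S_eq sum.union_disjoint[OF finite finite u_disj]
    by (simp only: period_eq_sum)
  have theta_mult: "theta (c * x) = theta x" if "c \<in> R" for c x
    using period_mult[OF that, of x] period_mult[OF that, of "u * x"]
    by (simp add: theta_def mult.left_commute[of u])
  have uu_period: "period (u * (u * x)) = period x" for x
    using period_mult[OF uu, of x] by (simp add: mult.assoc)
  let ?T = "card {x::'a. x ^ n = 1 \<and> (1 + x) ^ (2 * n) = 1}"
  let ?e0 = "period a" and ?e1 = "period (v * a)" and ?e2 = "period (u * a)" and ?e3 = "period (u * v * a)"
  have u_period: "period (u * (v * a)) = ?e3" "period (u * (u * a)) = ?e0" "period (u * (u * v * a)) = ?e1"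
    using uu_period[of a] uu_period[of "v * a"] by (simp_all only: mult.assoc)
  have theta_values: "theta a = ?e0 + ?e2" "theta (u * a) = ?e0 + ?e2" "theta (v * a) = ?e1 + ?e3"
      "theta (u * v * a) = ?e1 + ?e3" "theta 0 = 2 * int n"
    by (simp_all only: theta_def u_period mult_zero_right period_0)
  have m1: "int n + int n * (?e0 + ?e2 + ?e1 + ?e3) = 0"
    using cosets[of period] by (simp only: period_mult sum_period period_0)
  have m2: "int n * int n + int n * (?e0 * ?e0 + ?e2 * ?e2 + ?e1 * ?e1 + ?e3 * ?e3) = (4 * int n + 1) * int n"
  proof -
    have "(\<Sum>x\<in>UNIV. period x * period x) = (4 * int n + 1) * int n"
      using sum_period_period[of 1] one by (simp add: card_q distrib_right)
    then show ?thesis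
      using cosets[of "\<lambda>x. period x * period x"] by (simp only: period_mult period_0)
  qed
  have m2': "int n * int n + int n * (2 * (?e0 * ?e2) + 2 * (?e1 * ?e3)) = 0"
  proof -
    have inv: "period (c * x) * period (u * (c * x)) = period x * period (u * x)" if "c \<in> R" for c x
      using period_mult[OF that, of x] period_mult[OF that, of "u * x"] by (simp only: mult.left_commute)
    have "(\<Sum>x\<in>UNIV. period x * period (u * x)) = 0"
      using sum_period_period[OF u0] uv(2) by simp
    then have "int n * int n + int n * (?e0 * ?e2 + ?e2 * ?e0 + ?e1 * ?e3 + ?e3 * ?e1) = 0"
      using cosets[of "\<lambda>x. period x * period (u * x)", OF inv]
      by (simp only: u_period mult_zero_right period_0)
    then show ?thesis by (simp add: algebra_simps)
  qed
  have m3: "int n * int n * (2 * int n) + int n * (?e0 * ?e0 * (?e0 + ?e2) + ?e2 * ?e2 * (?e0 + ?e2)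
      + ?e1 * ?e1 * (?e1 + ?e3) + ?e3 * ?e3 * (?e1 + ?e3)) = (4 * int n + 1) * (int n * ?T)"
  proof -
    have inv: "period (c * x) * period (c * x) * theta (c * x) = period x * period x * theta x" if "c \<in> R" for c x
      by (simp only: period_mult[OF that] theta_mult[OF that])
    have "(\<Sum>x\<in>UNIV. period x * period x * theta x) = (4 * int n + 1) * (int n * ?T)"
      unfolding sum_period_period_theta[OF theta] by (simp add: card_q distrib_right)
    then show ?thesis
      using cosets[of "\<lambda>x. period x * period x * theta x", OF inv]
      by (simp only: theta_values period_0)
  qed
  have e: "?e0 = ?e2 \<or> ?e0 = ?e1" using uv(5) eq by metis
  have "0 < int n" using n0 by simp
  then obtain U where U: "U\<^sup>2 = 4 * int n + 1"
      "8 * int ?T + 7 = U * (U - 2) \<or> 8 * int ?T + 7 = U * (U + 2)"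
    by (rule quartic_period_relation[OF _ m1 m2 m2' m3 e])
  have "int p dvd U" using U(1) by (intro p_dvd_square_root_card) (simp add: card_q)
  then have "int p dvd U * (U - 2)" "int p dvd U * (U + 2)" by (rule dvd_mult2)+
  then have "int p dvd 8 * int ?T + 7" using U(2) by (elim disjE) (simp_all only:)
  then have "int p dvd int (8 * ?T + 7)" by simp
  then have "p dvd 8 * ?T + 7" by (simp only: of_nat_dvd_iff)
  moreover have "p dvd 8 * ?T + 7 + (2 * n choose n)"
  proof -
    have "(- 1 :: 'a) ^ n = 1"
      using minus_one_in_R by (simp only: R_def mem_Collect_eq)
    moreover have "4 * n = CARD('a) - 1" using card_q by simp
    ultimately have "of_nat (8 * ?T + 7 + (2 * n choose n)) = (0 :: 'a)"
      by (rule card_consecutive_quartic_square_residues[rotated])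
    then show ?thesis by (simp only: of_nat_eq_0_iff_char_dvd char)
  qed
  ultimately have "p dvd (2 * n choose n)" by (simp only: dvd_add_right_iff)
  then show False using p_not_dvd_central_binomial by contradiction
qed

section \<open>Energies of generalized Paley graphs\<close>

text \<open>A whole coset of period \<open>n\<close>, together with 0, would already exceed the
  second moment. Hence removing the value \<open>n\<close> from the eigenvalues discards only the
  index 0.\<close>

lemma period_neq_degree:
  assumes "k \<le> n" "a \<noteq> 0"
  shows "period a \<noteq> int n"
proof
  assume eq: "period a = int n"
  have one: "1 \<in> R" by (simp add: R_def)
  have inj: "inj_on (\<lambda>c. c * a) R" using assms(2) by (auto simp: inj_on_def)
  have sub: "insert 0 ((\<lambda>c. c * a) ` R) \<subseteq> {x. period x = int n}"
    using eq by (auto simp: period_mult period_0)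
  have "0 \<notin> (\<lambda>c. c * a) ` R" using assms(2) zero_notin_R by auto
  then have "card (insert 0 ((\<lambda>c. c * a) ` R)) = n + 1"
    by (simp add: card_image[OF inj] card_R)
  then have "n + 1 \<le> card {x. period x = int n}"
    using card_mono[OF _ sub] by simp
  then have "int (n + 1) * (int n * int n) \<le> int (card {x. period x = int n}) * (int n * int n)"
    by (intro mult_right_mono) simp_all
  also have "\<dots> = (\<Sum>x\<in>{x. period x = int n}. period x * period x)" by simp
  also have "\<dots> \<le> (\<Sum>x\<in>UNIV. period x * period x)"
    by (rule sum_mono2) auto
  also have "\<dots> = int ((k * n + 1) * n)"
    using sum_period_period[of 1] one by (simp add: card_eq)
  finally have "int ((n + 1) * n * n) \<le> int ((k * n + 1) * n)"
    by (simp only: of_nat_mult mult.assoc)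
  then have "(n + 1) * n * n \<le> (k * n + 1) * n" by (simp only: of_nat_le_iff)
  then have "(n + 1) * n \<le> k * n + 1" using n0 by (simp only: mult_le_cancel2)
  moreover have "k * n \<le> n * n" using assms(1) by (rule mult_le_mono1)
  moreover have "(n + 1) * n = n * n + n" by simp
  ultimately have "n \<le> 1" by linarith
  then show False using assms(1) k by simp
qed

lemma nonprincipal_eigenvalues_gp_graph:
  assumes "k \<le> n"
  shows "nonprincipal_eigenvalues (gp_graph k :: 'a graph) = eta ` (UNIV - {0})"
proof -
  have "principal_eigenvalue (gp_graph k :: 'a graph) = of_nat n"
    using principal_eigenvalue_gp_graph[of k, where ?'a = 'a] R_eq card_R by simp
  moreover have "gp_graph k = (\<lambda>v w :: 'a. w - v \<in> R)"
    by (simp add: gp_graph_def R_eq)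
  ultimately have "nonprincipal_eigenvalues (gp_graph k :: 'a graph) = range eta - {of_nat n}"
    by (auto simp: nonprincipal_eigenvalues_def eigenvalue_cayley_iff)
  moreover have "eta a = of_nat n \<longleftrightarrow> a = 0" for a
  proof -
    have "eta a = of_nat n \<longleftrightarrow> (of_int (period a) :: complex) = of_int (int n)"
      by (simp add: eta_eq_period)
    also have "\<dots> \<longleftrightarrow> period a = int n" by (rule of_int_eq_iff)
    finally show ?thesis using period_neq_degree[OF assms] period_0 by metis
  qed
  ultimately show ?thesis by auto
qed

definition nonresidues :: "'a set" where "nonresidues = UNIV - insert 0 R"

lemma complement_gp_graph: "complement_graph (gp_graph k :: 'a graph) = (\<lambda>v w :: 'a. w - v \<in> nonresidues)"
  by (auto simp: complement_graph_def gp_graph_def nonresidues_def R_eq fun_eq_iff)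

text \<open>The field is the disjoint union of \<open>{0}\<close>, \<open>R\<close> and
  \<open>nonresidues\<close>, and the character sum over all of it vanishes unless
  \<open>a = 0\<close>.\<close>

lemma cayley_eigenvalue_complement:
  "cayley_eigenvalue nonresidues a = (if a = 0 then of_nat ((k - 1) * n) else - 1 - eta a)"
proof -
  have "(\<Sum>x\<in>UNIV. psi (a * x)) = cayley_eigenvalue nonresidues a + (\<Sum>x\<in>insert 0 R. psi (a * x))"
    unfolding cayley_eigenvalue_def nonresidues_def by (rule sum.subset_diff) auto
  then have eq: "cayley_eigenvalue nonresidues a = (if a = 0 then of_nat CARD('a) else 0) - (1 + eta a)"
    by (simp add: sum_psi cayley_eigenvalue_def)
  have "eta 0 = of_nat n" using period_0 by (simp add: eta_eq_period)
  moreover have "(k - 1) * n + n + 1 = CARD('a)"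
    using k card_eq by (simp add: diff_mult_distrib)
  then have "of_nat CARD('a) = (of_nat ((k - 1) * n) + of_nat n + 1 :: complex)"
    by (metis of_nat_1 of_nat_add)
  ultimately show ?thesis
    using eq by simp
qed

text \<open>The energy of the complement minus that of the graph is twice the difference between the
  number of positive periods at nonzero \<open>a\<close> and \<open>n\<close>.\<close>

lemma equienergetic_complement_iff:
  "equienergetic (gp_graph k :: 'a graph) (complement_graph (gp_graph k :: 'a graph))
    \<longleftrightarrow> card {a. a \<noteq> 0 \<and> period a > 0} = n"
proof -
  let ?P = "{a. a \<noteq> 0 \<and> period a > 0}" and ?U = "UNIV - {0 :: 'a}"
  have "energy (gp_graph k :: 'a graph) = (\<Sum>a\<in>UNIV. cmod (eta a))"
    using energy_cayley[of R] by (simp add: gp_graph_def R_eq)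
  also have "\<dots> = of_int (int n + (\<Sum>a\<in>?U. \<bar>period a\<bar>))"
    by (simp add: sum.remove[of UNIV "0::'a"] eta_eq_period norm_of_int period_0)
  finally have energy_G: "energy (gp_graph k :: 'a graph) = of_int (int n + (\<Sum>a\<in>?U. \<bar>period a\<bar>))" .
  have "energy (complement_graph (gp_graph k :: 'a graph)) = (\<Sum>a\<in>UNIV. cmod (cayley_eigenvalue nonresidues a))"
    using energy_cayley[of nonresidues] by (simp add: complement_gp_graph)
  also have "\<dots> = cmod (cayley_eigenvalue nonresidues 0) + (\<Sum>a\<in>?U. cmod (cayley_eigenvalue nonresidues a))"
    by (simp add: sum.remove[of UNIV "0::'a"])
  also have "cayley_eigenvalue nonresidues 0 = of_int (int ((k - 1) * n))"
    unfolding cayley_eigenvalue_complement by simp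
  also have "(\<Sum>a\<in>?U. cmod (cayley_eigenvalue nonresidues a)) = (\<Sum>a\<in>?U. of_int \<bar>- 1 - period a\<bar>)"
  proof (rule sum.cong[OF refl])
    fix a :: 'a assume "a \<in> ?U"
    then have "cayley_eigenvalue nonresidues a = of_int (- 1 - period a)"
      by (simp add: cayley_eigenvalue_complement eta_eq_period)
    then show "cmod (cayley_eigenvalue nonresidues a) = of_int \<bar>- 1 - period a\<bar>"
      by (simp only: norm_of_int of_int_abs)
  qed
  finally have energy_Gbar: "energy (complement_graph (gp_graph k :: 'a graph))
      = of_int (int ((k - 1) * n) + (\<Sum>a\<in>?U. \<bar>- 1 - period a\<bar>))"
    by (simp only: norm_of_int of_int_add of_int_sum of_int_abs norm_of_nat of_int_of_nat_eq)
  \<comment> \<open>Nonvanishing matters here: a zero period would raise the absolute value by 1, as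
    a positive one does.\<close>
  have "\<bar>- 1 - period a\<bar> = \<bar>period a\<bar> + (if a \<in> ?P then 2 else 0) - 1" if "a \<in> ?U" for a
    using that period_nonzero[of a] by auto
  then have "(\<Sum>a\<in>?U. \<bar>- 1 - period a\<bar>) = (\<Sum>a\<in>?U. \<bar>period a\<bar> + (if a \<in> ?P then 2 else 0) - 1)"
    by (rule sum.cong[OF refl])
  also have "\<dots> = (\<Sum>a\<in>?U. \<bar>period a\<bar>) + (\<Sum>a\<in>?U. if a \<in> ?P then 2 else 0) - int (card ?U)"
    by (simp add: sum.distrib sum_subtractf)
  also have "(\<Sum>a\<in>?U. if a \<in> ?P then 2 else 0 :: int) = (\<Sum>a\<in>?P. 2)"
    by (rule sum.mono_neutral_cong_right) auto
  also have "card ?U = k * n" using kn by (simp add: card_Diff_singleton)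
  finally have sum: "(\<Sum>a\<in>?U. \<bar>- 1 - period a\<bar>) = (\<Sum>a\<in>?U. \<bar>period a\<bar>) + 2 * int (card ?P) - int (k * n)"
    by simp
  have kn_int: "int ((k - 1) * n) = int (k * n) - int n"
    using k by (simp add: diff_mult_distrib of_nat_diff)
  have "equienergetic (gp_graph k :: 'a graph) (complement_graph (gp_graph k :: 'a graph))
      \<longleftrightarrow> int n + (\<Sum>a\<in>?U. \<bar>period a\<bar>) = int ((k - 1) * n) + (\<Sum>a\<in>?U. \<bar>- 1 - period a\<bar>)"
    unfolding equienergetic_def energy_G energy_Gbar of_int_eq_iff ..
  also have "\<dots> \<longleftrightarrow> int (card ?P) = int n"
    unfolding sum kn_int by auto
  finally show ?thesis by simp
qed

text \<open>The units with positive period form a union of cosets of size \<open>n\<close>. By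
  \<open>inj\<close> the cosets correspond to the distinct values, so there are \<open>n\<close>
  such units exactly when there is one positive value.\<close>

lemma equienergetic_complement_iff_ex1:
  assumes "k \<le> n"
    and inj: "\<And>a b. a \<noteq> 0 \<Longrightarrow> b \<noteq> 0 \<Longrightarrow> period a = period b \<Longrightarrow> b / a \<in> R"
  shows "equienergetic (gp_graph k :: 'a graph) (complement_graph (gp_graph k :: 'a graph))
    \<longleftrightarrow> (\<exists>!x::real. complex_of_real x \<in> nonprincipal_eigenvalues (gp_graph k :: 'a graph) \<and> x > 0)"
proof -
  let ?P = "{a. a \<noteq> 0 \<and> period a > 0}"
  have mem: "complex_of_real x \<in> nonprincipal_eigenvalues (gp_graph k :: 'a graph) \<and> x > 0
      \<longleftrightarrow> (\<exists>a\<in>?P. x = of_int (period a))" for x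
  proof -
    have eq: "complex_of_real x = eta a \<longleftrightarrow> x = of_int (period a)" for a
    proof -
      have "eta a = complex_of_real (of_int (period a))" by (simp add: eta_eq_period)
      then show ?thesis by (simp only: of_real_eq_iff)
    qed
    have "complex_of_real x \<in> nonprincipal_eigenvalues (gp_graph k :: 'a graph)
        \<longleftrightarrow> (\<exists>a. a \<noteq> 0 \<and> x = of_int (period a))"
      unfolding nonprincipal_eigenvalues_gp_graph[OF assms(1)] image_iff eq by blast
    then show ?thesis by auto
  qed
  have coset: "(\<lambda>c. c * a) ` R \<subseteq> ?P" "card ((\<lambda>c. c * a) ` R) = n" if "a \<in> ?P" for a
  proof -
    have "c \<noteq> 0" if "c \<in> R" for c using that zero_notin_R by blast
    then show "(\<lambda>c. c * a) ` R \<subseteq> ?P" using that by (auto simp: period_mult)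
    have "inj_on (\<lambda>c. c * a) R" using that by (auto simp: inj_on_def)
    then show "card ((\<lambda>c. c * a) ` R) = n" by (simp add: card_image card_R)
  qed
  have "card ?P = n \<longleftrightarrow> (\<exists>!x::real. \<exists>a\<in>?P. x = of_int (period a))"
  proof
    assume card_P: "card ?P = n"
    have "?P \<noteq> {}"
    proof
      assume "?P = {}"
      then have "n = 0" using card_P by (simp only: card.empty)
      then show False using n0 by simp
    qed
    then obtain a where a: "a \<in> ?P" by blast
    have "card ((\<lambda>c. c * a) ` R) = card ?P" using coset(2)[OF a] card_P by (simp only:)
    then have "(\<lambda>c. c * a) ` R = ?P" by (rule card_subset_eq[OF finite coset(1)[OF a]])
    have "period b = period a" if "b \<in> ?P" for b
    proof -
      have "b \<in> (\<lambda>c. c * a) ` R" using that unfolding \<open>(\<lambda>c. c * a) ` R = ?P\<close> .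
      then obtain c where "b = c * a" "c \<in> R" by (rule imageE)
      then show ?thesis by (simp only: period_mult)
    qed
    then have uniq: "x = of_int (period a)" if "\<exists>b\<in>?P. x = of_int (period b)" for x :: real
      using that by (elim bexE) (simp only:)
    show "\<exists>!x::real. \<exists>a\<in>?P. x = of_int (period a)"
    proof (rule ex1I)
      show "\<exists>b\<in>?P. real_of_int (period a) = of_int (period b)" using a by (rule bexI[rotated]) (rule refl)
    qed (rule uniq)
  next
    assume ex1: "\<exists>!x::real. \<exists>a\<in>?P. x = of_int (period a)"
    then obtain a where a: "a \<in> ?P" by blast
    have "?P \<subseteq> (\<lambda>c. c * a) ` R"
    proof
      fix b assume b: "b \<in> ?P"
      then have "real_of_int (period b) = of_int (period a)" using ex1 a by blast
      then have "period a = period b" by simp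
      then have "b / a \<in> R" using inj[of a b] a b by simp
      then have "b / a * a \<in> (\<lambda>c. c * a) ` R" by blast
      then show "b \<in> (\<lambda>c. c * a) ` R" using a by simp
    qed
    then have "(\<lambda>c. c * a) ` R = ?P" using coset(1)[OF a] by blast
    then show "card ?P = n" using coset(2)[OF a] by simp
  qed
  then show ?thesis
    unfolding equienergetic_complement_iff mem .
qed

section \<open>Energy of the sum graph and separation of the three spectra\<close>

lemma equienergetic_gp_sum_graph: "equienergetic (gp_graph k :: 'a graph) (gp_sum_graph k :: 'a graph)"
  using energy_difference_graph_eq_energy_sum_graph[of R]
  by (simp add: equienergetic_def gp_graph_def gp_sum_graph_def R_eq[symmetric])

lemma sum_spectrum_gp_graph: "(\<Sum>\<mu>\<in>#graph_spectrum (gp_graph k :: 'a graph). \<mu>) = 0"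
  unfolding sum_graph_spectrum by (simp add: gp_graph_def flip: R_eq)

lemma sum_spectrum_complement_gp_graph:
  "(\<Sum>\<mu>\<in>#graph_spectrum (complement_graph (gp_graph k :: 'a graph)). \<mu>) = 0"
  unfolding sum_graph_spectrum by (simp add: complement_graph_def)

text \<open>In odd characteristic the vertex 1/2 carries a loop, as 1 is a \<open>k\<close>-th
  power.\<close>

lemma sum_spectrum_gp_sum_graph:
  assumes "p \<noteq> 2"
  shows "(\<Sum>\<mu>\<in>#graph_spectrum (gp_sum_graph k :: 'a graph). \<mu>) \<noteq> 0"
proof -
  have "\<not> p dvd 2" using assms p1 dvd_imp_le[of p 2] by auto
  then have "of_nat 2 \<noteq> (0::'a)"
    by (simp only: of_nat_eq_0_iff_char_dvd char not_False_eq_True)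
  then have two: "(2::'a) \<noteq> 0" by simp
  have "1 / 2 + 1 / 2 = 2 * (1 / 2 :: 'a)" by (simp only: mult_2)
  also have "\<dots> = 1" using two by simp
  finally have "1 / 2 \<in> {v::'a. gp_sum_graph k v v}"
    by (auto simp add: gp_sum_graph_def power_residues_def intro!: exI[of _ 1])
  then have "card {v::'a. gp_sum_graph k v v} \<noteq> 0" by auto
  then show ?thesis
    unfolding sum_graph_spectrum[of "gp_sum_graph k :: 'a graph"] by (simp only: of_nat_eq_0_iff not_False_eq_True)
qed

text \<open>The values of \<open>psi\<close> are roots of unity, so eigenvalues of the graph have
  absolute value at most \<open>n\<close>, whereas the complement has the larger eigenvalue
  \<open>(k - 1) * n\<close>.\<close>

lemma not_isospectral_complement:
  assumes "k > 2"
  shows "\<not> isospectral (gp_graph k :: 'a graph) (complement_graph (gp_graph k :: 'a graph))"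
proof
  assume "isospectral (gp_graph k :: 'a graph) (complement_graph (gp_graph k :: 'a graph))"
  moreover have "graph_spectrum (gp_graph k :: 'a graph) = image_mset eta (mset_set UNIV)"
    using graph_spectrum_cayley[of R] by (simp add: gp_graph_def R_eq[symmetric])
  moreover have "graph_spectrum (complement_graph (gp_graph k :: 'a graph))
      = image_mset (cayley_eigenvalue nonresidues) (mset_set UNIV)"
    unfolding complement_gp_graph by (rule graph_spectrum_cayley)
  ultimately have "image_mset eta (mset_set UNIV) = image_mset (cayley_eigenvalue nonresidues) (mset_set UNIV)"
    unfolding isospectral_def by metis
  then have "set_mset (image_mset eta (mset_set UNIV)) = set_mset (image_mset (cayley_eigenvalue nonresidues) (mset_set UNIV))"
    by (rule arg_cong)
  then have "range eta = range (cayley_eigenvalue nonresidues)"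
    by simp
  then have "cayley_eigenvalue nonresidues 0 \<in> range eta" by (simp only: rangeI)
  then obtain a where "cayley_eigenvalue nonresidues 0 = eta a" by (rule rangeE)
  then have "eta a = of_nat ((k - 1) * n)"
    by (simp only: cayley_eigenvalue_complement if_True simp_thms)
  then have "cmod (eta a) = real ((k - 1) * n)"
    by (simp only: norm_of_nat)
  have unit: "cmod (psi x) = 1" for x
  proof -
    have "cmod (psi x) = 1 \<or> p = 0" by (rule power_eq_1_iff[OF psi_power_p])
    then show ?thesis using p1 by (elim disjE) simp_all
  qed
  have "cmod (eta a) \<le> (\<Sum>x\<in>R. cmod (psi (a * x)))"
    unfolding cayley_eigenvalue_def by (rule norm_sum)
  also have "\<dots> = real n"
    by (simp only: unit sum_constant card_R mult_1_right)
  finally have "real ((k - 1) * n) \<le> real n"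
    by (simp only: \<open>cmod (eta a) = real ((k - 1) * n)\<close>)
  then have "(k - 1) * n \<le> 1 * n" by (simp only: of_nat_le_iff mult_1)
  then have "k - 1 \<le> 1" using n0 by (simp only: mult_le_cancel2)
  then show False using assms by simp
qed

end

section \<open>From the hypotheses on \<open>k\<close> and \<open>q\<close> to the setting of
  Gaussian periods\<close>

theorem theorem4p2:
  fixes p m q k :: nat
    and G Gplus Gbar :: "'a::{field,finite} graph"
  assumes "prime p"
    and "q = p ^ m"
    and "CARD('a) = q"
    and "k \<in> {3, 4}"
    and "k dvd (q - 1) div (p - 1)"
    and "\<not> semiprimitive_pair k q"
    and "G = gp_graph k"
    and "Gplus = gp_sum_graph k"
    and "Gbar = complement_graph G"
  shows "(equienergetic G Gbar \<longleftrightarrow>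
            (\<exists>!x::real. complex_of_real x \<in> nonprincipal_eigenvalues G \<and> x > 0))
       \<and> (equienergetic G Gbar \<longrightarrow>
            equienergetic G Gplus \<and> equienergetic G Gbar \<and> equienergetic Gplus Gbar \<and>
            \<not> isospectral G Gplus \<and> \<not> isospectral G Gbar \<and> \<not> isospectral Gplus Gbar)"
proof -
  have card: "CARD('a) = p ^ m" using assms(2,3) by simp
  have p1: "p > 1" using assms(1) prime_gt_1_nat by blast
  have m0: "m > 0" using card one_less_card_field[where ?'a = 'a] by (cases m) auto
  have k34: "k = 3 \<or> k = 4" using assms(4) by auto
  have "[p = 1] (mod (p - 1))" using p1 by (simp add: cong_altdef_nat)
  then have "p - 1 dvd q - 1"
    using assms(2) by (metis cong_pow cong_to_1_nat power_one)
  \<comment> \<open>The degree appears as \<open>(p - 1) * c\<close>, which exhibits its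
    divisibility by \<open>p - 1\<close>.\<close>
  moreover obtain c where c: "(q - 1) div (p - 1) = k * c" using assms(5) by (elim dvdE)
  ultimately have kn: "k * ((p - 1) * c) = CARD('a) - 1"
    using assms(3) by (metis dvd_mult_div_cancel mult.left_commute)
  have "c \<noteq> 0"
  proof
    assume "c = 0"
    then have "CARD('a) - 1 = 0" using kn by simp
    then show False using one_less_card_field[where ?'a = 'a] by simp
  qed
  have power_eq: "p ^ m = k * ((p - 1) * c) + 1"
    using kn card one_less_card_field[where ?'a = 'a] by simp
  have p_dvd: "p dvd p ^ m" using m0 by simp
  have "\<not> k dvd p"
  proof
    assume "k dvd p"
    then have "k dvd k * ((p - 1) * c) + 1"
      using p_dvd unfolding power_eq by (rule dvd_trans)
    then have "k dvd 1" by (simp only: dvd_add_right_iff dvd_triv_left)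
    then show False using k34 by auto
  qed
  have not_even: "\<not> even p" if "k = 4"
  proof
    assume "even p"
    then have "even (k * ((p - 1) * c) + 1)"
      using p_dvd unfolding power_eq by (rule dvd_trans)
    then show False using that by simp
  qed
  \<comment> \<open>The exponent 1 suffices: the only units modulo 3 and 4 are 1 and -1, so
    \<open>p\<close> must be congruent to 1.\<close>
  have "\<not> [- 1 = int p ^ 1] (mod int k)"
    using assms(1,2,6) m0 unfolding semiprimitive_pair_def by blast
  then have "p mod k \<noteq> k - 1"
  proof (rule contrapos_nn)
    assume "p mod k = k - 1"
    then have "int p mod int k = int (k - 1)" by (metis zmod_int)
    then show "[- 1 = int p ^ 1] (mod int k)"
      using k34 by (auto simp: cong_def)
  qed
  then have "p mod k = 1"
    using k34 \<open>\<not> k dvd p\<close> not_even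
    by (elim disjE) (presburger+)
  then have k_dvd: "k dvd p - 1"
    using dvd_minus_mod[of k p] by simp
  obtain psi :: "'a \<Rightarrow> complex" where psi: "additive_character psi"
    using ex_additive_character[OF assms(1) card] by blast
  interpret additive_character psi by (rule psi)
  interpret gaussian_periods psi p m k "(p - 1) * c"
    by unfold_locales (use assms(1) card kn k34 k_dvd in auto)
  \<comment> \<open>The bound \<open>k \<le> n\<close> is what separates the degree from the other
    periods.\<close>
  have "k \<le> p - 1" using k_dvd p1 by (intro dvd_imp_le) auto
  also have "\<dots> \<le> (p - 1) * c" using \<open>c \<noteq> 0\<close> by simp
  finally have le: "k \<le> (p - 1) * c" .
  have inj: "b / a \<in> R" if "a \<noteq> 0" "b \<noteq> 0" "period a = period b" for a b
    using k34
  proof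
    assume "k = 3"
    then show ?thesis by (rule quotient_in_R_if_period_eq_cubic[OF _ that])
  next
    assume "k = 4"
    then show ?thesis by (rule quotient_in_R_if_period_eq_quartic[OF _ that])
  qed
  have iff: "equienergetic G Gbar \<longleftrightarrow>
      (\<exists>!x::real. complex_of_real x \<in> nonprincipal_eigenvalues G \<and> x > 0)"
    unfolding assms(7-9) by (rule equienergetic_complement_iff_ex1[OF le inj])
  have plus: "equienergetic G Gplus"
    unfolding assms(7,8) by (rule equienergetic_gp_sum_graph)
  have plus_bar: "equienergetic Gplus Gbar" if "equienergetic G Gbar"
    using that plus by (simp only: equienergetic_def)
  have "p \<noteq> 2" using k_dvd k34 by auto
  then have sum_plus: "(\<Sum>\<mu>\<in>#graph_spectrum Gplus. \<mu>) \<noteq> 0"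
    unfolding assms(8) by (rule sum_spectrum_gp_sum_graph)
  have sum_G: "(\<Sum>\<mu>\<in>#graph_spectrum G. \<mu>) = 0"
    unfolding assms(7) by (rule sum_spectrum_gp_graph)
  have sum_bar: "(\<Sum>\<mu>\<in>#graph_spectrum Gbar. \<mu>) = 0"
    unfolding assms(7,9) by (rule sum_spectrum_complement_gp_graph)
  have "\<not> isospectral G Gplus" "\<not> isospectral Gplus Gbar"
    unfolding isospectral_def using sum_plus sum_G sum_bar by metis+
  moreover have "k > 2" using k34 by auto
  then have "\<not> isospectral G Gbar"
    unfolding assms(7,9) by (rule not_isospectral_complement)
  ultimately show ?thesis using iff plus plus_bar by blast
qed

end
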